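(* Let $T_1,T_2,T_3,T_4\in\mathcal{B}_A(\mathcal{H})$. Then $$w_{\mathbb{A}}\left(\begin{bmatrix}T_1&T_2\\ T_3&T_4\end{bmatrix}\right)\le\max\{w_A(T_1),w_A(T_4)\}+\left[\frac{1}{16}\|P\|_A^2+\frac18 w_A(PT_3T_2+T_3T_2P)+\frac14 w_A^2(T_3T_2)\right]^{1/4},$$ and $$w_{\mathbb{A}}\left(\begin{bmatrix}T_1&T_2\\ T_3&T_4\end{bmatrix}\right)\ge\max\left\{w_A(T_1),\ w_A(T_4),\ \left[\frac{1}{16}\|P\|_A^2+\frac18 c_A(PT_3T_2+T_3T_2P)+\frac14 m_A^2(T_3T_2)\right]^{1/4}\right\},$$ where $P=T_2^{\#_A}T_2+T_3T_3^{\#_A}$ and $m_A(T_3T_2)=\displaystyle\inf_{\theta\in\mathbb{R}}\ \inf_{x\in\mathcal{H},\ \|x\|_A=1}\|Re_A(e^{i\theta}T_3T_2)x\|_A$.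
   Context: $\mathcal{H}$ is a complex Hilbert space with inner product $\langle\cdot,\cdot\rangle$, $\mathcal{B}(\mathcal{H})$ is the algebra of bounded linear operators on $\mathcal{H}$, and $A\in\mathcal{B}(\mathcal{H})$ is a nonzero positive operator, i.e. $A$ is selfadjoint and $\langle Ax,x\rangle\ge 0$ for all $x$. Put $\langle x,y\rangle_A=\langle Ax,y\rangle$ and $\|x\|_A=\sqrt{\langle x,x\rangle_A}$. $\mathcal{R}(\cdot)$ denotes range, and $\mathcal{B}_A(\mathcal{H})=\{T\in\mathcal{B}(\mathcal{H}):\mathcal{R}(T^*A)\subseteq\mathcal{R}(A)\}$. For $T\in\mathcal{B}_A(\mathcal{H})$: $T^{\#_A}$ denotes the distinguished $A$-adjoint of $T$, i.e. the unique $X\in\mathcal{B}(\mathcal{H})$ with $AX=T^*A$ and $\mathcal{R}(X)\subseteq\overline{\mathcal{R}(A)}$ (equivalently $T^{\#_A}=A^\dagger T^*A$, with $A^\dagger$ the Moore-Penrose inverse of $A$); $Re_A(T)=\frac{T+T^{\#_A}}{2}$; the $A$-operator seminorm is $\|T\|_A=\sup\{\|Tx\|_A/\|x\|_A: x\in\overline{\mathcal{R}(A)},\ x\ne 0\}$; the $A$-numerical radius is $w_A(T)=\sup\{|\langle Tx,x\rangle_A|:x\in\mathcal{H},\ \|x\|_A=1\}$; and the $A$-Crawford number is $c_A(T)=\inf\{|\langle Tx,x\rangle_A|:x\in\mathcal{H},\ \|x\|_A=1\}$. $\mathbb{A}=\mathrm{diag}(A,A)$ is the positive operator on $\mathcal{H}\oplus\mathcal{H}$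 with diagonal entries $A$, and $w_{\mathbb{A}}$ is defined in the same way with $\mathcal{H}\oplus\mathcal{H}$ and $\mathbb{A}$ in place of $\mathcal{H}$ and $A$. $w_A^2(\cdot)$ means $(w_A(\cdot))^2$ and $m_A^2$ means $(m_A)^2$. *)

theory Defs
  imports "HOL-Analysis.Analysis"
begin

text \<open>
  Complex inner product spaces are built on top of the real ones.  The axiom \<open>Re_cinner\<close> makes the
  real part of the complex inner product the given real inner product, so positive definiteness,
  the norm and the topology of \<open>cinner\<close> are those of \<open>real_inner\<close> (see \<open>cinner_self\<close> below).
  The inner product is linear in its first argument.
\<close>

class complex_inner = real_inner +
  fixes scaleC :: "complex \<Rightarrow> 'a \<Rightarrow> 'a"  (infixr "*\<^sub>C" 75)
    and cinner :: "'a \<Rightarrow> 'a \<Rightarrow> complex"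
  assumes scaleC_add_right: "c *\<^sub>C (x + y) = c *\<^sub>C x + c *\<^sub>C y"
    and scaleC_add_left: "(c + d) *\<^sub>C x = c *\<^sub>C x + d *\<^sub>C x"
    and scaleC_scaleC: "c *\<^sub>C (d *\<^sub>C x) = (c * d) *\<^sub>C x"
    and scaleC_one: "1 *\<^sub>C x = x"
    and scaleR_scaleC: "r *\<^sub>R x = complex_of_real r *\<^sub>C x"
    and cinner_commute: "cinner x y = cnj (cinner y x)"
    and cinner_add_left: "cinner (x + y) z = cinner x z + cinner y z"
    and cinner_scaleC_left: "cinner (c *\<^sub>C x) y = c * cinner x y"
    and Re_cinner: "Re (cinner x y) = x \<bullet> y"

class chilbert_space = complex_inner + complete_space

lemma cinner_self: "cinner x x = complex_of_real ((norm x)\<^sup>2)"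
proof (rule complex_eqI)
  have "Im (cinner x x) = - Im (cinner x x)"
    by (metis cinner_commute cnj.simps(2))
  then show "Im (cinner x x) = Im (complex_of_real ((norm x)\<^sup>2))"
    by simp
qed (simp add: Re_cinner power2_norm_eq_inner)

text \<open>The Hilbert sum \<open>\<H> \<oplus> \<H>\<close> is the product type.\<close>

instantiation prod :: (complex_inner, complex_inner) complex_inner
begin

definition scaleC_prod :: "complex \<Rightarrow> 'a \<times> 'b \<Rightarrow> 'a \<times> 'b"
  where "scaleC_prod c z = (c *\<^sub>C fst z, c *\<^sub>C snd z)"

definition cinner_prod :: "'a \<times> 'b \<Rightarrow> 'a \<times> 'b \<Rightarrow> complex"
  where "cinner_prod z w = cinner (fst z) (fst w) + cinner (snd z) (snd w)"

instance
proof
  fix x y z :: "'a \<times> 'b" and c d :: complex and r :: real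
  show "c *\<^sub>C (x + y) = c *\<^sub>C x + c *\<^sub>C y"
    by (simp add: scaleC_prod_def scaleC_add_right)
  show "(c + d) *\<^sub>C x = c *\<^sub>C x + d *\<^sub>C x"
    by (simp add: scaleC_prod_def scaleC_add_left)
  show "c *\<^sub>C (d *\<^sub>C x) = (c * d) *\<^sub>C x"
    by (simp add: scaleC_prod_def scaleC_scaleC)
  show "1 *\<^sub>C x = x"
    by (simp add: scaleC_prod_def scaleC_one)
  show "r *\<^sub>R x = complex_of_real r *\<^sub>C x"
    by (simp add: scaleC_prod_def scaleR_prod_def scaleR_scaleC)
  show "cinner x y = cnj (cinner y x)"
    unfolding cinner_prod_def complex_cnj_add
    by (metis cinner_commute)
  show "cinner (x + y) z = cinner x z + cinner y z"
    by (simp add: cinner_prod_def cinner_add_left)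
  show "cinner (c *\<^sub>C x) y = c * cinner x y"
    by (simp add: cinner_prod_def scaleC_prod_def cinner_scaleC_left distrib_left)
  show "Re (cinner x y) = x \<bullet> y"
    by (simp add: cinner_prod_def inner_prod_def Re_cinner)
qed

end

instance prod :: (chilbert_space, chilbert_space) chilbert_space ..

definition bounded_clinear :: "('a::complex_inner \<Rightarrow> 'b::complex_inner) \<Rightarrow> bool"
  where "bounded_clinear T \<longleftrightarrow> bounded_linear T \<and> (\<forall>c x. T (c *\<^sub>C x) = c *\<^sub>C T x)"

text \<open>For a bounded \<open>T\<close> the operator described here exists by the Riesz representation theorem.\<close>

definition cadjoint :: "('a::chilbert_space \<Rightarrow> 'a) \<Rightarrow> 'a \<Rightarrow> 'a"
  where "cadjoint T = (THE S. \<forall>x y. cinner (T x) y = cinner x (S y))"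

definition positive_op :: "('a::chilbert_space \<Rightarrow> 'a) \<Rightarrow> bool"
  where "positive_op A \<longleftrightarrow>
    bounded_clinear A \<and> cadjoint A = A \<and> (\<forall>x. cinner (A x) x \<in> \<real>\<^sub>\<ge>\<^sub>0)"

definition cinner_A :: "('a::chilbert_space \<Rightarrow> 'a) \<Rightarrow> 'a \<Rightarrow> 'a \<Rightarrow> complex"
  where "cinner_A A x y = cinner (A x) y"

definition norm_A :: "('a::chilbert_space \<Rightarrow> 'a) \<Rightarrow> 'a \<Rightarrow> real"
  where "norm_A A x = sqrt (Re (cinner_A A x x))"

definition B_A :: "('a::chilbert_space \<Rightarrow> 'a) \<Rightarrow> ('a \<Rightarrow> 'a) set"
  where "B_A A = {T. bounded_clinear T \<and> range (cadjoint T \<circ> A) \<subseteq> range A}"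

text \<open>For \<open>T \<in> B_A A\<close> the operator described here exists by Douglas's range inclusion theorem.\<close>

definition adjoint_A :: "('a::chilbert_space \<Rightarrow> 'a) \<Rightarrow> ('a \<Rightarrow> 'a) \<Rightarrow> 'a \<Rightarrow> 'a"
  where "adjoint_A A T =
    (THE X. bounded_clinear X \<and> A \<circ> X = cadjoint T \<circ> A \<and> range X \<subseteq> closure (range A))"

definition Re_A :: "('a::chilbert_space \<Rightarrow> 'a) \<Rightarrow> ('a \<Rightarrow> 'a) \<Rightarrow> 'a \<Rightarrow> 'a"
  where "Re_A A T = (\<lambda>x. (1/2) *\<^sub>C (T x + adjoint_A A T x))"

text \<open>
  The suprema and infima below are real-valued.  For nonzero positive \<open>A\<close> and operators \<open>T\<close> in
  \<open>B_A A\<close> they range over nonempty sets that are bounded on the relevant side, since such \<open>T\<close> are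
  bounded with respect to \<open>norm_A A\<close>; outside that setting the values carry no meaning.
\<close>

definition opnorm_A :: "('a::chilbert_space \<Rightarrow> 'a) \<Rightarrow> ('a \<Rightarrow> 'a) \<Rightarrow> real"
  where "opnorm_A A T = (SUP x\<in>{x \<in> closure (range A). x \<noteq> 0}. norm_A A (T x) / norm_A A x)"

definition w_A :: "('a::chilbert_space \<Rightarrow> 'a) \<Rightarrow> ('a \<Rightarrow> 'a) \<Rightarrow> real"
  where "w_A A T = (SUP x\<in>{x. norm_A A x = 1}. cmod (cinner_A A (T x) x))"

definition c_A :: "('a::chilbert_space \<Rightarrow> 'a) \<Rightarrow> ('a \<Rightarrow> 'a) \<Rightarrow> real"
  where "c_A A T = (INF x\<in>{x. norm_A A x = 1}. cmod (cinner_A A (T x) x))"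

definition m_A :: "('a::chilbert_space \<Rightarrow> 'a) \<Rightarrow> ('a \<Rightarrow> 'a) \<Rightarrow> real"
  where "m_A A T = (INF \<theta>::real. INF x\<in>{x. norm_A A x = 1}.
    norm_A A (Re_A A (\<lambda>y. exp (\<i> * complex_of_real \<theta>) *\<^sub>C T y) x))"

definition block_op ::
    "('a::chilbert_space \<Rightarrow> 'a) \<Rightarrow> ('a \<Rightarrow> 'a) \<Rightarrow> ('a \<Rightarrow> 'a) \<Rightarrow> ('a \<Rightarrow> 'a) \<Rightarrow> 'a \<times> 'a \<Rightarrow> 'a \<times> 'a"
  where "block_op T1 T2 T3 T4 = (\<lambda>(x, y). (T1 x + T2 y, T3 x + T4 y))"

definition diag_op :: "('a::chilbert_space \<Rightarrow> 'a) \<Rightarrow> 'a \<times> 'a \<Rightarrow> 'a \<times> 'a"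
  where "diag_op A = block_op A (\<lambda>_. 0) (\<lambda>_. 0) A"

end

theory Submission
  imports Defs
begin

text \<open>
  Write \<open>\<langle>x, y\<rangle>\<close> for the semi-inner product \<open>cinner (A x) y\<close> and \<open>#\<close> for the adjoint with respect to it.

  The theorem compares the numerical radius of a block matrix with the quadratic form
  \<open>\<langle>T2 y, x\<rangle> + \<langle>T3 x, y\<rangle>\<close> of its off-diagonal part.  For a unimodular \<open>\<phi>\<close> and \<open>\<omega> = \<phi>\<^sup>2\<close> the real part of \<open>\<phi>\<close>
  times this form is \<open>Re \<langle>cnj \<phi> B y, x\<rangle>\<close> with \<open>B = \<omega> T2 + T3#\<close>.  Hence the numerical radius of the
  off-diagonal part is half of the supremum over \<open>\<omega>\<close> of the seminorm of \<open>B\<close>.  The Gram operator of \<open>B\<close>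
  is \<open>Q = P + 2 R\<close>, where \<open>S = T3 T2\<close> and \<open>R\<close> is the real part of \<open>\<omega> S\<close> (lemma \<open>ip_B_B\<close>), and
  expanding a square gives
  \<open>\<parallel>Q y\<parallel>\<^sup>2 = \<parallel>P y\<parallel>\<^sup>2 + 4 \<parallel>R y\<parallel>\<^sup>2 + 2 Re (\<omega> \<langle>(P S + S P) y, y\<rangle>)\<close>  (lemma \<open>nA_Q_square\<close>).
  Estimating the three terms from above by suprema gives the upper bound (lemma \<open>cmod_off_le\<close>).
  Choosing \<open>\<omega>\<close> so that the last term is twice the modulus of \<open>\<langle>(P S + S P) y, y\<rangle>\<close> gives the lower bound
  (lemma \<open>root_le_if_off_le\<close>).

  For the whole matrix, the diagonal contributes at most the larger of the numerical radii of \<open>T1\<close> and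
  \<open>T4\<close> to the upper bound.  Conversely the matrix dominates its diagonal entries, by vectors with one
  component zero, and its off-diagonal part, by averaging over a change of sign in the second
  component.

  All of this needs the suprema to be finite and the adjoint \<open>#\<close> to exist.  Existence is Douglas's range
  inclusion theorem (lemma \<open>adjoint_A_exists\<close>), obtained from orthogonal projection, the Riesz
  representation theorem and uniform boundedness.  Finiteness follows from the theorem of Krein, Lax
  and Reid that symmetric operators are bounded for the seminorm (lemma \<open>symmetric_imp_bounded_A\<close>).
\<close>

section \<open>Projection, representation and uniform boundedness in Hilbert space\<close>

lemma subspace_closure:
  fixes S :: "'a::real_normed_vector set"
  assumes "subspace S"
  shows "subspace (closure S)"
proof (rule subspaceI)
  show "0 \<in> closure S"
    using assms closure_subset subspace_0 by blast
next
  fix x y assume "x \<in> closure S" "y \<in> closure S"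
  then obtain f g where "\<And>n. f n \<in> S" "f \<longlonglongrightarrow> x" "\<And>n. g n \<in> S" "g \<longlonglongrightarrow> y"
    unfolding closure_sequential by blast
  then show "x + y \<in> closure S"
    unfolding closure_sequential using subspace_add[OF assms]
    by (intro exI[of _ "\<lambda>n. f n + g n"]) (auto intro: tendsto_add)
next
  fix c x assume "x \<in> closure S"
  then obtain f where "\<And>n. f n \<in> S" "f \<longlonglongrightarrow> x"
    unfolding closure_sequential by blast
  then show "c *\<^sub>R x \<in> closure S"
    unfolding closure_sequential using subspace_scale[OF assms]
    by (intro exI[of _ "\<lambda>n. c *\<^sub>R f n"]) (auto intro: tendsto_scaleR)
qed

text \<open>
  A minimizing sequence for the distance from \<open>x\<close> to \<open>M\<close> is Cauchy by the parallelogram law; its limit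
  is the closest point of \<open>M\<close>, and minimality makes the remainder orthogonal to \<open>M\<close>.
\<close>

lemma orthogonal_decomposition:
  fixes M :: "'a::{real_inner, complete_space} set"
  assumes "subspace M" "closed M"
  obtains m k where "x = m + k" "m \<in> M" "\<And>y. y \<in> M \<Longrightarrow> k \<bullet> y = 0"
proof -
  define d where "d = infdist x M"
  have M0: "0 \<in> M" "M \<noteq> {}"
    using assms subspace_0 by auto
  have d_le: "d\<^sup>2 \<le> (norm (x - y))\<^sup>2" if "y \<in> M" for y
    using infdist_le[OF that, of x] infdist_nonneg[of x M]
    by (simp add: d_def dist_norm power_mono)
  have "\<exists>y\<in>M. (norm (x - y))\<^sup>2 < d\<^sup>2 + inverse (real (Suc n))" for n
  proof (rule ccontr)
    assume "\<not> ?thesis"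
    then have "sqrt (d\<^sup>2 + inverse (real (Suc n))) \<le> dist x y" if "y \<in> M" for y
      using that by (auto simp: dist_norm not_less intro: real_le_lsqrt)
    then have "sqrt (d\<^sup>2 + inverse (real (Suc n))) \<le> d"
      unfolding d_def infdist_def using M0 by (auto intro: cINF_greatest)
    then have "d\<^sup>2 + inverse (real (Suc n)) \<le> d\<^sup>2"
      by (metis d_def infdist_nonneg real_sqrt_le_iff real_sqrt_unique)
    then show False by simp
  qed
  then obtain m where m: "\<And>n. m n \<in> M"
      "\<And>n. (norm (x - m n))\<^sup>2 < d\<^sup>2 + inverse (real (Suc n))"
    by metis
  have step: "(norm (m i - m j))\<^sup>2 \<le> 2 * inverse (real (Suc i)) + 2 * inverse (real (Suc j))" for i j
  proof -
    have "(1/2) *\<^sub>R (m i + m j) \<in> M"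
      using m assms(1) by (simp add: subspace_add subspace_scale)
    then have "d\<^sup>2 \<le> (norm (x - (1/2) *\<^sub>R (m i + m j)))\<^sup>2"
      by (rule d_le)
    moreover have "(norm (m i - m j))\<^sup>2 + 4 * (norm (x - (1/2) *\<^sub>R (m i + m j)))\<^sup>2
        = 2 * (norm (x - m i))\<^sup>2 + 2 * (norm (x - m j))\<^sup>2"
      by (simp add: power2_norm_eq_inner algebra_simps inner_commute)
    ultimately show ?thesis
      using m(2)[of i] m(2)[of j] by linarith
  qed
  have "Cauchy m"
  proof (rule metric_CauchyI)
    fix e :: real assume "0 < e"
    then obtain N where N: "inverse (real (Suc N)) < e\<^sup>2 / 4"
      by (metis reals_Archimedean zero_less_power zero_less_divide_iff zero_less_numeral)
    have "dist (m i) (m j) < e" if "i \<ge> N" "j \<ge> N" for i j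
    proof -
      have "inverse (real (Suc i)) \<le> inverse (real (Suc N))"
        "inverse (real (Suc j)) \<le> inverse (real (Suc N))"
        using that by (auto intro: le_imp_inverse_le)
      then have "(norm (m i - m j))\<^sup>2 < e\<^sup>2"
        using step[of i j] N by linarith
      then show ?thesis
        using \<open>0 < e\<close> by (simp add: dist_norm power2_less_imp_less)
    qed
    then show "\<exists>N. \<forall>i\<ge>N. \<forall>j\<ge>N. dist (m i) (m j) < e"
      by blast
  qed
  then obtain l where l: "m \<longlonglongrightarrow> l"
    using Cauchy_convergent convergent_def by blast
  have "l \<in> M"
    using assms(2) l m(1) closed_sequentially by blast
  have "(\<lambda>n. (norm (x - m n))\<^sup>2) \<longlonglongrightarrow> (norm (x - l))\<^sup>2"
    by (intro tendsto_intros l)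
  moreover have "(\<lambda>n. d\<^sup>2 + inverse (real (Suc n))) \<longlonglongrightarrow> d\<^sup>2 + 0"
    by (intro tendsto_intros LIMSEQ_inverse_real_of_nat)
  ultimately have l_min: "(norm (x - l))\<^sup>2 \<le> d\<^sup>2"
    using m(2) by (intro LIMSEQ_le[where X = "\<lambda>n. (norm (x - m n))\<^sup>2"]) (auto intro: less_imp_le)
  have "(x - l) \<bullet> y = 0" if "y \<in> M" for y
  proof (cases "y = 0")
    case False
    define t where "t = ((x - l) \<bullet> y) / (y \<bullet> y)"
    have "l + t *\<^sub>R y \<in> M"
      using that \<open>l \<in> M\<close> assms(1) by (simp add: subspace_add subspace_scale)
    then have "(norm (x - l))\<^sup>2 \<le> (norm ((x - l) - t *\<^sub>R y))\<^sup>2"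
      using d_le l_min by (metis diff_diff_eq order.trans)
    also have "\<dots> = (norm (x - l))\<^sup>2 - 2 * t * ((x - l) \<bullet> y) + t\<^sup>2 * (y \<bullet> y)"
      unfolding power2_norm_eq_inner
      by (simp add: inner_diff_left inner_diff_right inner_commute power2_eq_square algebra_simps)
    also have "\<dots> = (norm (x - l))\<^sup>2 - ((x - l) \<bullet> y)\<^sup>2 / (y \<bullet> y)"
      using False by (simp add: t_def power2_eq_square field_simps)
    finally have "((x - l) \<bullet> y)\<^sup>2 / (y \<bullet> y) \<le> 0"
      by simp
    moreover have "0 < y \<bullet> y"
      using False by simp
    ultimately show ?thesis
      by (simp add: divide_le_0_iff not_le)
  qed simp
  with that[of l "x - l"] \<open>l \<in> M\<close> show ?thesis
    by simp
qed

text \<open>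
  A vector \<open>k\<close> orthogonal to the kernel represents \<open>f\<close> up to a factor, because \<open>x\<close> differs from a
  multiple of \<open>k\<close> by an element of the kernel.
\<close>

lemma Riesz_representation:
  fixes f :: "'a::{real_inner, complete_space} \<Rightarrow> real"
  assumes "bounded_linear f"
  obtains z where "\<And>x. f x = x \<bullet> z"
proof (cases "\<forall>x. f x = 0")
  case True
  with that[of 0] show ?thesis by simp
next
  case False
  interpret f: bounded_linear f by fact
  from False obtain u where u: "f u \<noteq> 0" by blast
  have "subspace {x. f x = 0}"
    by (simp add: subspace_def f.add f.scaleR)
  moreover have "closed {x. f x = 0}"
    by (intro closed_Collect_eq continuous_intros f.continuous_on)
  ultimately obtain m k where mk: "u = m + k" "f m = 0" "\<And>y. f y = 0 \<Longrightarrow> k \<bullet> y = 0"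
    by (metis (mono_tags, lifting) mem_Collect_eq orthogonal_decomposition)
  then have fk: "f k \<noteq> 0"
    using u f.add by simp
  then have kk: "k \<bullet> k \<noteq> 0"
    using f.zero by auto
  have "f x = x \<bullet> ((f k / (k \<bullet> k)) *\<^sub>R k)" for x
  proof -
    have "f (x - (f x / f k) *\<^sub>R k) = 0"
      using fk by (simp add: f.diff f.scaleR)
    then have "k \<bullet> (x - (f x / f k) *\<^sub>R k) = 0"
      by (rule mk(3))
    then show ?thesis
      using fk kk by (simp add: inner_diff_right inner_commute field_simps)
  qed
  then show ?thesis by (rule that)
qed

text \<open>
  The uniform boundedness principle for functionals on a Hilbert space: by Baire's theorem one of the
  closed sets on which all functionals from \<open>F\<close> are bounded by \<open>n\<close> contains a ball.
\<close>

lemma weakly_bounded_imp_bounded: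
  fixes F :: "'a::{real_inner, complete_space} set"
  assumes "\<And>x. \<exists>b. \<forall>v\<in>F. \<bar>x \<bullet> v\<bar> \<le> b"
  obtains b where "\<And>v. v \<in> F \<Longrightarrow> norm v \<le> b"
proof -
  define C where "C n = (\<Inter>v\<in>F. {x. \<bar>x \<bullet> v\<bar> \<le> real n})" for n
  have closed: "closed (C n)" for n
    unfolding C_def by (intro closed_INT ballI closed_Collect_le continuous_intros)
  have "(\<Union>n. C n) = UNIV"
  proof -
    have "\<exists>n. x \<in> C n" for x
    proof -
      obtain b where b: "\<And>v. v \<in> F \<Longrightarrow> \<bar>x \<bullet> v\<bar> \<le> b"
        using assms by blast
      moreover obtain n where "b \<le> real n"
        using real_arch_simple by blast
      ultimately show ?thesis
        unfolding C_def by (blast intro: order.trans)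
    qed
    then show ?thesis by blast
  qed
  then have "interior (\<Union>(range C)) \<noteq> {}"
    by simp
  moreover have "interior (\<Union>(range C)) = {}" if "\<And>n. interior (C n) = {}"
    using Baire_category_alt[of "euclidean :: 'a topology" "range C"] that closed
    by (auto simp: completely_metrizable_space_euclidean)
  ultimately obtain n where "interior (C n) \<noteq> {}"
    by blast
  then obtain a e where "0 < e" and ball: "cball a e \<subseteq> C n"
    by (meson ex_in_conv mem_interior_cball)
  have "norm v \<le> 2 * real n / e" if "v \<in> F" for v
  proof (cases "v = 0")
    case False
    define y where "y = (e / norm v) *\<^sub>R v"
    have "a + y \<in> C n" "a \<in> C n"
      using ball \<open>0 < e\<close> False by (auto simp: y_def subset_iff dist_norm)
    then have "\<bar>(a + y) \<bullet> v\<bar> \<le> n" "\<bar>a \<bullet> v\<bar> \<le> n"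
      using that by (auto simp: C_def)
    then have "y \<bullet> v \<le> 2 * n"
      by (simp add: inner_add_left)
    moreover have "y \<bullet> v = e * norm v"
      using False by (simp add: y_def power2_norm_eq_inner[symmetric] power2_eq_square)
    ultimately show ?thesis
      using \<open>0 < e\<close> by (simp add: field_simps)
  qed (use \<open>0 < e\<close> in simp)
  then show ?thesis by (rule that)
qed

section \<open>Adjoints in complex Hilbert space\<close>

lemma cinner_add_right: "cinner x (y + z) = cinner x y + cinner x z"
  by (metis cinner_add_left cinner_commute complex_cnj_add)

lemma cinner_scaleC_right: "cinner x (c *\<^sub>C y) = cnj c * cinner x y"
  by (metis cinner_commute cinner_scaleC_left complex_cnj_mult)

text \<open>
  The imaginary part of \<open>cinner x y\<close> is the real inner product of a rotated vector with \<open>y\<close>.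
\<close>

lemma cinner_eqI:
  assumes "\<And>c. (c *\<^sub>C x) \<bullet> y = (c *\<^sub>C x') \<bullet> y'"
  shows "cinner x y = cinner x' y'"
proof (rule complex_eqI)
  show "Re (cinner x y) = Re (cinner x' y')"
    using assms[of 1] by (simp add: Re_cinner scaleC_one)
  show "Im (cinner x y) = Im (cinner x' y')"
    using assms[of "- \<i>"] by (simp flip: Re_cinner add: cinner_scaleC_left)
qed

lemma bounded_clinearD:
  assumes "bounded_clinear T"
  shows "bounded_linear T" "T (x + y) = T x + T y" "T (c *\<^sub>C x) = c *\<^sub>C T x"
    "T (r *\<^sub>R x) = r *\<^sub>R T x" "T 0 = 0" "T (x - y) = T x - T y"
proof -
  show bl: "bounded_linear T" and "T (c *\<^sub>C x) = c *\<^sub>C T x"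
    using assms by (auto simp: bounded_clinear_def)
  show "T (x + y) = T x + T y" "T (r *\<^sub>R x) = r *\<^sub>R T x" "T 0 = 0" "T (x - y) = T x - T y"
    using bl by (auto simp: linear_simps)
qed

lemma bounded_clinear_add:
  "bounded_clinear S \<Longrightarrow> bounded_clinear T \<Longrightarrow> bounded_clinear (\<lambda>x. S x + T x)"
  by (simp add: bounded_clinear_def bounded_linear_add scaleC_add_right)

lemma bounded_clinear_compose:
  "bounded_clinear S \<Longrightarrow> bounded_clinear T \<Longrightarrow> bounded_clinear (S \<circ> T)"
  by (auto simp: bounded_clinear_def o_def intro: bounded_linear_compose)

lemma bounded_linear_scaleC: "bounded_linear (\<lambda>x::'a::complex_inner. c *\<^sub>C x)"
proof (rule bounded_linear_intro[where K = "cmod c"])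
  fix x :: 'a
  have "cinner (c *\<^sub>C x) (c *\<^sub>C x) = (c * cnj c) * cinner x x"
    by (simp add: cinner_scaleC_left cinner_scaleC_right)
  then have "complex_of_real ((norm (c *\<^sub>C x))\<^sup>2) = complex_of_real ((cmod c * norm x)\<^sup>2)"
    unfolding cinner_self by (simp only: complex_norm_square[symmetric] power_mult_distrib of_real_mult of_real_power)
  then have "norm (c *\<^sub>C x) = cmod c * norm x"
    by (simp only: of_real_eq_iff) (simp add: power2_eq_iff_nonneg)
  then show "norm (c *\<^sub>C x) \<le> norm x * cmod c"
    by simp
qed (simp_all add: scaleC_add_right scaleR_scaleC scaleC_scaleC mult.commute)

lemma bounded_clinear_scaleC:
  "bounded_clinear T \<Longrightarrow> bounded_clinear (\<lambda>x. c *\<^sub>C T x)"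
  using bounded_linear_compose[OF bounded_linear_scaleC]
  by (auto simp: bounded_clinear_def scaleC_scaleC mult.commute)

text \<open>
  The real representation theorem is enough for the complex adjoint: a complex linear \<open>T\<close> commutes with
  the rotations by which the real inner product determines the complex one.
\<close>

lemma cadjoint_works:
  assumes "bounded_clinear T"
  shows "cinner (T x) y = cinner x (cadjoint T y)"
proof -
  have "\<exists>z. \<forall>x. T x \<bullet> y = x \<bullet> z" for y
    using Riesz_representation[of "\<lambda>x. T x \<bullet> y"] bounded_clinearD(1)[OF assms]
    by (metis bounded_linear_inner_left_comp)
  then obtain S where S: "\<And>x y. T x \<bullet> y = x \<bullet> S y"
    by metis
  have S: "\<forall>x y. cinner (T x) y = cinner x (S y)"
    using S by (auto intro!: cinner_eqI simp flip: bounded_clinearD(3)[OF assms])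
  moreover have "S' = S" if "\<forall>x y. cinner (T x) y = cinner x (S' y)" for S'
  proof
    fix y
    have "x \<bullet> S' y = x \<bullet> S y" for x
      by (metis Re_cinner S that)
    then show "S' y = S y"
      by (metis vector_eq_ldot)
  qed
  ultimately have "\<forall>x y. cinner (T x) y = cinner x (cadjoint T y)"
    unfolding cadjoint_def by (rule theI)
  then show ?thesis by blast
qed

section \<open>Elementary facts about real and complex numbers\<close>

text \<open>
  Log-convexity makes the ratios of consecutive terms increase, so a first ratio above \<open>K\<close> would force
  the sequence to grow faster than \<open>K ^ k\<close>.
\<close>

lemma log_convex_growth:
  fixes a :: "nat \<Rightarrow> real"
  assumes convex: "\<And>k. (a (Suc k))\<^sup>2 \<le> a (Suc (Suc k)) * a k"
    and nonneg: "\<And>k. 0 \<le> a k"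
    and growth: "\<And>k. a k \<le> C * K ^ k"
    and K: "0 < K"
  shows "a 1 \<le> K * a 0"
proof (cases "a 0 = 0")
  case True
  then show ?thesis using convex[of 0] by simp
next
  case False
  then have a0: "0 < a 0" using nonneg[of 0] by simp
  show ?thesis
  proof (rule ccontr)
    define q where "q = a 1 / a 0"
    assume "\<not> ?thesis"
    then have q: "K < q" using a0 by (simp add: q_def field_simps)
    have "0 < a k \<and> q * a k \<le> a (Suc k)" for k
    proof (induction k)
      case 0
      then show ?case using a0 by (simp add: q_def)
    next
      case (Suc k)
      then have pos: "0 < a (Suc k)"
        using q K by (smt (verit) mult_pos_pos)
      have "(q * a k) * a (Suc k) \<le> a (Suc k) * a (Suc k)"
        using Suc pos by (intro mult_right_mono) auto
      also have "\<dots> \<le> a (Suc (Suc k)) * a k"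
        using convex by (simp add: power2_eq_square)
      finally have "a k * (q * a (Suc k)) \<le> a k * a (Suc (Suc k))"
        by (simp add: ac_simps)
      then show ?case
        using pos Suc by (simp add: mult_le_cancel_left_pos)
    qed
    note step = this
    have geometric: "q ^ k * a 0 \<le> a k" for k
    proof (induction k)
      case (Suc k)
      have "q ^ Suc k * a 0 \<le> q * a k"
        using Suc q K by (simp add: mult.assoc mult_left_mono)
      also have "\<dots> \<le> a (Suc k)" using step by blast
      finally show ?case .
    qed simp
    obtain k where "C / a 0 < (q / K) ^ k"
      using real_arch_pow[of "q / K" "C / a 0"] q K by auto
    then have "C * K ^ k < q ^ k * a 0"
      using a0 K by (simp add: power_divide field_simps)
    then show False
      using geometric[of k] growth[of k] by linarith
  qed
qed

text \<open>
  Used to recover a norm from a quadratic form: \<open>a\<close> is the seminorm of the image of a vector of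
  seminorm \<open>b\<close>, and \<open>t\<close> is the factor by which the image is rescaled when it is inserted into the form.
  The best choice is \<open>t = b / a\<close>.
\<close>

lemma le_if_scaled_le:
  fixes a b W :: real
  assumes "\<And>t. 0 < t \<Longrightarrow> t * a\<^sup>2 \<le> W * (t\<^sup>2 * a\<^sup>2 + b\<^sup>2)"
    and "0 \<le> a" "0 \<le> b" "0 \<le> W"
  shows "a \<le> 2 * W * b"
proof (cases "a = 0")
  case False
  then have a: "0 < a" using assms by simp
  show ?thesis
  proof (cases "b = 0")
    case True
    \<comment> \<open>For \<open>b = 0\<close> any positive \<open>t\<close> with \<open>W * t < 1\<close> gives a contradiction.\<close>
    define t where "t = 1 / (2 * (W + 1))"
    have t: "0 < t" "W * t < 1"
      using assms(4) by (auto simp: t_def field_simps)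
    have "(t * a\<^sup>2) * 1 \<le> (t * a\<^sup>2) * (W * t)"
      using assms(1)[OF t(1)] True by (simp add: power2_eq_square ac_simps)
    then have "1 \<le> W * t"
      using t(1) a by (subst (asm) mult_le_cancel_left_pos) auto
    with t show ?thesis by simp
  next
    case False
    then have b: "0 < b" using assms by simp
    have "(b / a) * a\<^sup>2 \<le> W * ((b / a)\<^sup>2 * a\<^sup>2 + b\<^sup>2)"
      using a b by (intro assms(1)) simp
    then have "b * a \<le> b * (2 * W * b)"
      using a by (simp add: power2_eq_square algebra_simps)
    then show ?thesis
      using b by (simp add: mult_le_cancel_left_pos)
  qed
qed (use assms in simp)

lemma ex_unimodular_rotation: "\<exists>c. cmod c = 1 \<and> c * z = complex_of_real (cmod z)"
proof (cases "z = 0")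
  case True
  then show ?thesis by (intro exI[of _ 1]) simp
next
  case False
  have "cnj z * z = complex_of_real (cmod z) * complex_of_real (cmod z)"
    by (metis complex_norm_square mult.commute power2_eq_square of_real_mult)
  with False show ?thesis
    by (intro exI[of _ "cnj z / cmod z"]) (simp add: norm_divide field_simps)
qed

section \<open>The semi-inner product of a positive operator\<close>

definition bounded_A :: "('a::chilbert_space \<Rightarrow> 'a) \<Rightarrow> ('a \<Rightarrow> 'a) \<Rightarrow> bool"
  where "bounded_A A T \<longleftrightarrow> (\<exists>K\<ge>0. \<forall>x. norm_A A (T x) \<le> K * norm_A A x)"

locale nonzero_positive_operator =
  fixes A :: "'a::chilbert_space \<Rightarrow> 'a"
  assumes positive: "positive_op A" and nonzero: "A \<noteq> (\<lambda>_. 0)"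
begin

abbreviation ip :: "'a \<Rightarrow> 'a \<Rightarrow> complex" where "ip \<equiv> cinner_A A"

abbreviation nA :: "'a \<Rightarrow> real" where "nA \<equiv> norm_A A"

lemma bounded_clinear_A: "bounded_clinear A"
  using positive by (simp add: positive_op_def)

lemmas A_linear = bounded_clinearD[OF bounded_clinear_A]

lemma A_selfadjoint: "cinner (A x) y = cinner x (A y)"
  using positive cadjoint_works[OF bounded_clinear_A] by (simp add: positive_op_def)

lemma ip_commute: "ip x y = cnj (ip y x)"
  unfolding cinner_A_def by (metis A_selfadjoint cinner_commute)

lemma ip_add_left: "ip (x + y) z = ip x z + ip y z"
  and ip_scaleC_left: "ip (c *\<^sub>C x) z = c * ip x z"
  and ip_add_right: "ip z (x + y) = ip z x + ip z y"
  and ip_scaleC_right: "ip z (c *\<^sub>C x) = cnj c * ip z x"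
  by (simp_all add: cinner_A_def A_linear cinner_add_left cinner_add_right cinner_scaleC_left
      cinner_scaleC_right)

lemma ip_self: "ip x x = complex_of_real ((nA x)\<^sup>2)"
proof -
  have "ip x x \<in> \<real>\<^sub>\<ge>\<^sub>0"
    using positive by (simp add: positive_op_def cinner_A_def)
  then show ?thesis
    by (auto simp: norm_A_def nonneg_Reals_def simp flip: of_real_power)
qed

lemma Re_ip_self: "Re (ip x x) = (nA x)\<^sup>2"
  by (simp add: ip_self)

lemma nA_nonneg [simp]: "0 \<le> nA x"
proof -
  have "ip x x \<in> \<real>\<^sub>\<ge>\<^sub>0"
    using positive by (simp add: positive_op_def cinner_A_def)
  then show ?thesis
    by (auto simp: norm_A_def nonneg_Reals_def)
qed

lemma nA_scaleC: "nA (c *\<^sub>C x) = cmod c * nA x"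
proof -
  have "ip (c *\<^sub>C x) (c *\<^sub>C x) = (c * cnj c) * ip x x"
    by (simp add: ip_scaleC_left ip_scaleC_right)
  then have "complex_of_real ((nA (c *\<^sub>C x))\<^sup>2) = complex_of_real ((cmod c * nA x)\<^sup>2)"
    unfolding ip_self by (simp only: complex_norm_square[symmetric] power_mult_distrib of_real_mult of_real_power)
  then show ?thesis
    by (simp only: of_real_eq_iff) (simp add: power2_eq_iff_nonneg)
qed

lemma nA_add_square: "(nA (x + y))\<^sup>2 = (nA x)\<^sup>2 + (nA y)\<^sup>2 + 2 * Re (ip x y)"
proof -
  have "Re (ip y x) = Re (ip x y)"
    by (metis cnj.simps(1) ip_commute)
  then show ?thesis
    by (simp flip: Re_ip_self add: ip_add_left ip_add_right)
qed

lemma Cauchy_Schwarz_A: "cmod (ip x y) \<le> nA x * nA y"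
proof -
  have real: "Re (ip x y) \<le> nA x * nA y" for x y
  proof -
    \<comment> \<open>The usual scaling by the norms needs them nonzero; adding a positive number covers null vectors.\<close>
    have eps: "Re (ip x y) \<le> (nA x + e) * (nA y + e)" if "0 < e" for e :: real
    proof -
      define a b where "a = nA x + e" and "b = nA y + e"
      have ab: "0 < a" "0 < b" "nA x \<le> a" "nA y \<le> b"
        using that by (simp_all add: a_def b_def add_nonneg_pos)
      have "0 \<le> (nA (complex_of_real b *\<^sub>C x + complex_of_real (- a) *\<^sub>C y))\<^sup>2"
        by simp
      also have "\<dots> = (b * nA x)\<^sup>2 + (a * nA y)\<^sup>2 - 2 * (a * b) * Re (ip x y)"
        unfolding nA_add_square nA_scaleC ip_scaleC_left ip_scaleC_right
        using ab by (simp add: power_mult_distrib)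
      finally have "2 * (a * b) * Re (ip x y) \<le> (b * nA x)\<^sup>2 + (a * nA y)\<^sup>2"
        by simp
      also have "\<dots> \<le> (b * a)\<^sup>2 + (a * b)\<^sup>2"
        using ab by (intro add_mono power_mono mult_left_mono) auto
      also have "\<dots> = 2 * (a * b) * (a * b)"
        by (simp add: power2_eq_square)
      finally have "Re (ip x y) \<le> a * b"
        using ab by (simp add: mult_le_cancel_left_pos)
      then show ?thesis
        by (simp add: a_def b_def)
    qed
    have "((\<lambda>e. (nA x + e) * (nA y + e)) \<longlongrightarrow> (nA x + 0) * (nA y + 0)) (at_right 0)"
      by (intro tendsto_intros)
    then have "Re (ip x y) \<le> (nA x + 0) * (nA y + 0)"
      by (rule tendsto_lowerbound) (simp_all add: eventually_at_right_field eps exI[of _ 1])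
    then show ?thesis by simp
  qed
  obtain c where c: "cmod c = 1" "c * ip x y = complex_of_real (cmod (ip x y))"
    using ex_unimodular_rotation by blast
  have "cmod (ip x y) = Re (ip (c *\<^sub>C x) y)"
    by (simp add: ip_scaleC_left c)
  also have "\<dots> \<le> nA x * nA y"
    using real[of "c *\<^sub>C x" y] by (simp add: nA_scaleC c)
  finally show ?thesis .
qed

lemma Re_ip_le: "Re (ip x y) \<le> nA x * nA y"
  using Cauchy_Schwarz_A complex_Re_le_cmod order.trans by blast

lemma nA_le_if_square:
  assumes "(nA x)\<^sup>2 \<le> b * nA x" "0 \<le> b"
  shows "nA x \<le> b"
  using assms by (cases "nA x = 0") (simp_all add: power2_eq_square less_le)

lemma nA_triangle: "nA (x + y) \<le> nA x + nA y"
proof (rule power2_le_imp_le)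
  show "(nA (x + y))\<^sup>2 \<le> (nA x + nA y)\<^sup>2"
    unfolding nA_add_square using Re_ip_le[of x y] by (simp add: power2_eq_square algebra_simps)
qed simp

lemma nA_null: "A k = 0 \<Longrightarrow> nA k = 0"
  by (simp add: norm_A_def cinner_A_def) (metis Re_cinner inner_zero_left)

lemma ex_unit: "\<exists>u. nA u = 1"
proof -
  obtain x where "A x \<noteq> 0"
    using nonzero by blast
  then have "0 < Re (ip x (A x))"
    by (simp add: cinner_A_def Re_cinner)
  then have "nA x \<noteq> 0"
    using Cauchy_Schwarz_A[of x "A x"] by auto
  then show ?thesis
    by (intro exI[of _ "complex_of_real (1 / nA x) *\<^sub>C x"]) (simp add: nA_scaleC norm_divide)
qed

section \<open>Existence of the adjoint for the semi-inner product\<close>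

text \<open>
  The remainder of the projection to the closed range is orthogonal to \<open>A (A k)\<close>, and selfadjointness
  turns this into \<open>A k = 0\<close>.
\<close>

lemma split_closure_range:
  obtains m k where "x = m + k" "m \<in> closure (range A)" "A k = 0"
proof -
  have "subspace (range A)"
    by (simp add: A_linear(1) bounded_linear.linear linear_subspace_image)
  from orthogonal_decomposition[OF subspace_closure[OF this] closed_closure, of x]
  obtain m k where mk: "x = m + k" "m \<in> closure (range A)"
      "\<And>y. y \<in> closure (range A) \<Longrightarrow> k \<bullet> y = 0"
    by blast
  have "A k \<bullet> A k = Re (cinner (A k) (A k))"
    by (simp add: Re_cinner)
  also have "\<dots> = k \<bullet> A (A k)"
    by (simp add: A_selfadjoint Re_cinner)
  also have "\<dots> = 0"
    using mk(3) closure_subset by blast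
  finally show ?thesis
    using that mk by simp
qed

lemma inj_on_closure_range:
  assumes "x \<in> closure (range A)" "y \<in> closure (range A)" "A x = A y"
  shows "x = y"
proof -
  have "subspace (range A)"
    by (simp add: A_linear(1) bounded_linear.linear linear_subspace_image)
  then have d: "x - y \<in> closure (range A)"
    using assms subspace_diff subspace_closure by blast
  have "closed {z. (x - y) \<bullet> z = 0}"
    by (intro closed_Collect_eq continuous_intros)
  moreover have "(x - y) \<bullet> A z = 0" for z
    using A_selfadjoint[of "x - y" z] assms(3) by (simp add: A_linear flip: Re_cinner)
      (metis Re_cinner inner_zero_left)
  ultimately have "closure (range A) \<subseteq> {z. (x - y) \<bullet> z = 0}"
    by (intro closure_minimal) auto
  with d show ?thesis by auto
qed

text \<open>
  The range condition says that \<open>T\<close> has a pointwise adjoint for the semi-inner product.  In this form it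
  is visibly preserved by products and scalar multiples.
\<close>

lemma B_A_iff: "T \<in> B_A A \<longleftrightarrow> bounded_clinear T \<and> (\<forall>x. \<exists>z. \<forall>y. ip (T y) x = ip y z)"
proof (cases "bounded_clinear T")
  case True
  have "cadjoint T (A x) = A z \<longleftrightarrow> (\<forall>y. ip (T y) x = ip y z)" for x z
  proof -
    have "ip (T y) x = cinner y (cadjoint T (A x))" "ip y z = cinner y (A z)" for y
      by (simp_all add: cinner_A_def A_selfadjoint cadjoint_works[OF True])
    then show ?thesis
      by (metis Re_cinner vector_eq_ldot)
  qed
  then show ?thesis
    using True by (simp add: B_A_def image_subset_iff image_iff)
qed (simp add: B_A_def)

text \<open>
  Douglas's theorem for the inclusion of \<open>range (cadjoint T \<circ> A)\<close> in \<open>range A\<close>.  Since \<open>A\<close> is injective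
  on the closure of its range, there is exactly one solution \<open>X x\<close> of \<open>A (X x) = cadjoint T (A x)\<close> there,
  and it depends linearly on \<open>x\<close>.  Boundedness is the point: testing against \<open>A y\<close> gives
  \<open>X x \<bullet> A y = x \<bullet> A (T y)\<close>, so the vectors \<open>A (T y)\<close> with \<open>norm (A y) \<le> 1\<close> are weakly bounded, hence
  bounded, and \<open>X x\<close> can be tested on the dense subspace \<open>range A\<close>.
\<close>

lemma adjoint_A_exists:
  assumes T: "T \<in> B_A A"
  shows "\<exists>X. bounded_clinear X \<and> A \<circ> X = cadjoint T \<circ> A \<and> range X \<subseteq> closure (range A)"
proof -
  have blT: "bounded_clinear T"
    using T by (simp add: B_A_def)
  have "\<exists>m \<in> closure (range A). \<forall>y. ip (T y) x = ip y m" for x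
  proof -
    obtain z where z: "\<And>y. ip (T y) x = ip y z"
      using T B_A_iff by blast
    obtain m k where "z = m + k" "m \<in> closure (range A)" "A k = 0"
      by (rule split_closure_range)
    then have "A z = A m" "m \<in> closure (range A)"
      by (simp_all add: A_linear)
    with z show ?thesis
      by (auto simp: cinner_A_def A_selfadjoint)
  qed
  then obtain X where X: "\<And>x. X x \<in> closure (range A)" "\<And>x y. ip (T y) x = ip y (X x)"
    by metis
  have AX: "A (X x) = cadjoint T (A x)" for x
  proof -
    have "cinner y (A (X x)) = cinner y (cadjoint T (A x))" for y
      using X(2)[of y x] by (simp add: cinner_A_def A_selfadjoint cadjoint_works[OF blT])
    then show ?thesis
      by (metis Re_cinner vector_eq_ldot)
  qed
  have X_eqI: "X x = z" if "z \<in> closure (range A)" "\<And>y. ip (T y) x = ip y z" for x z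
  proof (rule inj_on_closure_range[OF X(1) that(1)])
    have "cinner y (A (X x)) = cinner y (A z)" for y
      using X(2)[of y x] that(2)[of y] by (simp add: cinner_A_def A_selfadjoint)
    then show "A (X x) = A z"
      by (metis Re_cinner vector_eq_ldot)
  qed
  have sub: "subspace (closure (range A))"
    by (simp add: A_linear(1) bounded_linear.linear linear_subspace_image subspace_closure)
  have scale_closed: "c *\<^sub>C z \<in> closure (range A)" if "z \<in> closure (range A)" for c z
  proof -
    have "(\<lambda>z. c *\<^sub>C z) ` closure (range A) \<subseteq> closure ((\<lambda>z. c *\<^sub>C z) ` range A)"
      by (rule closure_bounded_linear_image_subset[OF bounded_linear_scaleC])
    also have "\<dots> \<subseteq> closure (range A)"
      by (intro closure_mono) (auto simp flip: A_linear(3))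
    finally show ?thesis using that by blast
  qed
  have X_add: "X (x + y) = X x + X y" for x y
    by (rule X_eqI) (simp_all add: X ip_add_right subspace_add[OF sub])
  have X_scale: "X (c *\<^sub>C x) = c *\<^sub>C X x" for c x
    by (rule X_eqI) (simp_all add: X scale_closed ip_scaleC_right)
  have X_dual: "X x \<bullet> A y = x \<bullet> A (T y)" for x y
    by (metis A_selfadjoint Re_cinner X(2) cinner_A_def inner_commute)
  obtain b where b: "\<And>y. norm (A y) \<le> 1 \<Longrightarrow> norm (A (T y)) \<le> b"
  proof (rule weakly_bounded_imp_bounded[of "(\<lambda>y. A (T y)) ` {y. norm (A y) \<le> 1}"])
    fix x
    have "\<bar>x \<bullet> A (T y)\<bar> \<le> norm (X x)" if "norm (A y) \<le> 1" for y
    proof -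
      have "\<bar>x \<bullet> A (T y)\<bar> \<le> norm (X x) * norm (A y)"
        unfolding X_dual[symmetric] by (rule Cauchy_Schwarz_ineq2)
      also have "\<dots> \<le> norm (X x)"
        using that by (simp add: mult_left_le)
      finally show ?thesis .
    qed
    then show "\<exists>b. \<forall>v\<in>(\<lambda>y. A (T y)) ` {y. norm (A y) \<le> 1}. \<bar>x \<bullet> v\<bar> \<le> b"
      by blast
  qed blast
  have "norm (X x) \<le> norm x * b" for x
  proof -
    have *: "X x \<bullet> v \<le> norm x * b * norm v" if "v \<in> range A" for v
    proof (cases "v = 0")
      case False
      from that obtain y where v: "v = A y" by blast
      have "norm (A ((1 / norm v) *\<^sub>R y)) \<le> 1"
        using False by (simp add: A_linear v)
      then have "norm (A (T ((1 / norm v) *\<^sub>R y))) \<le> b"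
        by (rule b)
      then have "norm (A (T y)) \<le> b * norm v"
        using False by (simp add: A_linear bounded_clinearD[OF blT] field_simps)
      then have "norm x * norm (A (T y)) \<le> norm x * (b * norm v)"
        by (intro mult_left_mono) auto
      moreover have "X x \<bullet> v \<le> norm x * norm (A (T y))"
        unfolding v X_dual by (rule norm_cauchy_schwarz)
      ultimately show ?thesis
        by (simp add: mult.assoc)
    qed simp
    have "closed {v. X x \<bullet> v \<le> norm x * b * norm v}"
      by (intro closed_Collect_le continuous_intros)
    then have "closure (range A) \<subseteq> {v. X x \<bullet> v \<le> norm x * b * norm v}"
      using * by (intro closure_minimal) auto
    then have "X x \<bullet> X x \<le> norm x * b * norm (X x)"
      using X(1) by blast
    then have "norm (X x) * norm (X x) \<le> norm x * b * norm (X x)"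
      by (simp add: power2_norm_eq_inner[symmetric] power2_eq_square)
    moreover have "0 \<le> b"
      using b[of 0] by (simp add: A_linear bounded_clinearD[OF blT])
    ultimately show ?thesis
      by (cases "X x = 0") auto
  qed
  then have "bounded_linear X"
    by (intro bounded_linear_intro[where K = b]) (simp_all add: X_add X_scale scaleR_scaleC)
  then have "bounded_clinear X"
    by (simp add: bounded_clinear_def X_scale)
  then show ?thesis
    using AX X(1) by (intro exI[of _ X]) auto
qed

lemma adjoint_A_props:
  assumes "T \<in> B_A A"
  shows "bounded_clinear (adjoint_A A T)" "ip (T x) y = ip x (adjoint_A A T y)"
proof -
  have blT: "bounded_clinear T"
    using assms by (simp add: B_A_def)
  have "\<exists>!X. bounded_clinear X \<and> A \<circ> X = cadjoint T \<circ> A \<and> range X \<subseteq> closure (range A)"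
  proof (rule ex_ex1I[OF adjoint_A_exists[OF assms]])
    fix X Y
    assume X: "bounded_clinear X \<and> A \<circ> X = cadjoint T \<circ> A \<and> range X \<subseteq> closure (range A)"
      and Y: "bounded_clinear Y \<and> A \<circ> Y = cadjoint T \<circ> A \<and> range Y \<subseteq> closure (range A)"
    show "X = Y"
    proof
      fix x
      show "X x = Y x"
      proof (rule inj_on_closure_range)
        show "X x \<in> closure (range A)" "Y x \<in> closure (range A)"
          using X Y by blast+
        show "A (X x) = A (Y x)"
          using X Y by (metis comp_apply)
      qed
    qed
  qed
  from theI'[OF this] have X: "bounded_clinear (adjoint_A A T)"
      "A \<circ> adjoint_A A T = cadjoint T \<circ> A"
    unfolding adjoint_A_def by blast+
  then show "bounded_clinear (adjoint_A A T)" by blast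
  have "A (adjoint_A A T y) = cadjoint T (A y)"
    using fun_cong[OF X(2)] by simp
  then show "ip (T x) y = ip x (adjoint_A A T y)"
    by (simp add: cinner_A_def A_selfadjoint cadjoint_works[OF blT])
qed

lemma B_A_compose:
  assumes "S \<in> B_A A" "T \<in> B_A A"
  shows "S \<circ> T \<in> B_A A"
  unfolding B_A_iff
proof (intro conjI allI)
  show "bounded_clinear (S \<circ> T)"
    using assms by (simp add: B_A_iff bounded_clinear_compose)
  fix x
  obtain z where z: "\<And>y. ip (S y) x = ip y z"
    using assms(1) B_A_iff by blast
  obtain w where "\<And>y. ip (T y) z = ip y w"
    using assms(2) B_A_iff by blast
  with z show "\<exists>z. \<forall>y. ip ((S \<circ> T) y) x = ip y z"
    by auto
qed

lemma B_A_scaleC: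
  assumes "T \<in> B_A A"
  shows "(\<lambda>x. c *\<^sub>C T x) \<in> B_A A"
  unfolding B_A_iff
proof (intro conjI allI)
  show "bounded_clinear (\<lambda>x. c *\<^sub>C T x)"
    using assms by (simp add: B_A_iff bounded_clinear_scaleC)
  fix x
  obtain z where "\<And>y. ip (T y) x = ip y z"
    using assms B_A_iff by blast
  then show "\<exists>z. \<forall>y. ip (c *\<^sub>C T y) x = ip y z"
    by (intro exI[of _ "cnj c *\<^sub>C z"]) (simp add: ip_scaleC_left ip_scaleC_right)
qed

section \<open>Boundedness with respect to the seminorm\<close>

lemma nA_le_norm: "\<exists>C\<ge>0. \<forall>x. nA x \<le> C * norm x"
proof -
  obtain K where K: "0 < K" "\<And>x. norm (A x) \<le> norm x * K"
    using bounded_linear.pos_bounded[OF A_linear(1)] by blast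
  have "nA x \<le> sqrt K * norm x" for x
  proof -
    have "(nA x)\<^sup>2 = A x \<bullet> x"
      by (simp add: cinner_A_def Re_cinner flip: Re_ip_self)
    also have "\<dots> \<le> norm (A x) * norm x"
      by (rule norm_cauchy_schwarz)
    also have "\<dots> \<le> (norm x * K) * norm x"
      using K by (intro mult_right_mono) auto
    also have "\<dots> = (sqrt K)\<^sup>2 * (norm x)\<^sup>2"
      using K(1) by (simp add: power2_eq_square)
    finally have "(nA x)\<^sup>2 \<le> (sqrt K * norm x)\<^sup>2"
      by (simp only: power_mult_distrib)
    then show ?thesis
      by (rule power2_le_imp_le) (use K in simp)
  qed
  then show ?thesis
    using K by (intro exI[of _ "sqrt K"]) auto
qed

text \<open>
  The theorem of Krein, Lax and Reid.  By the Cauchy-Schwarz inequality the seminorms of the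
  iterates \<open>(R ^^ k) x\<close> form a log-convex sequence, and they grow at most like the powers of the
  operator norm of \<open>R\<close>.
\<close>

lemma symmetric_imp_bounded_A:
  assumes R: "bounded_clinear R" and sym: "\<And>x y. ip (R x) y = ip x (R y)"
  shows "bounded_A A R"
proof -
  obtain C where C: "0 \<le> C" "\<And>x. nA x \<le> C * norm x"
    using nA_le_norm by blast
  obtain K where K: "0 < K" "\<And>x. norm (R x) \<le> norm x * K"
    using bounded_linear.pos_bounded[OF bounded_clinearD(1)[OF R]] by blast
  have "nA (R x) \<le> K * nA x" for x
  proof -
    define a where "a k = nA ((R ^^ k) x)" for k
    have norm_iter: "norm ((R ^^ k) x) \<le> K ^ k * norm x" for k
    proof (induction k)
      case (Suc k)
      have "norm ((R ^^ Suc k) x) \<le> norm ((R ^^ k) x) * K"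
        using K by simp
      also have "\<dots> \<le> (K ^ k * norm x) * K"
        using Suc K by (intro mult_right_mono) auto
      finally show ?case by (simp add: ac_simps)
    qed simp
    have "a 1 \<le> K * a 0"
    proof (rule log_convex_growth[where C = "C * norm x"])
      fix k
      have "(a (Suc k))\<^sup>2 = Re (ip ((R ^^ Suc (Suc k)) x) ((R ^^ k) x))"
        by (simp add: a_def sym flip: Re_ip_self)
      also have "\<dots> \<le> a (Suc (Suc k)) * a k"
        unfolding a_def by (rule Re_ip_le)
      finally show "(a (Suc k))\<^sup>2 \<le> a (Suc (Suc k)) * a k" .
      have "a k \<le> C * norm ((R ^^ k) x)"
        unfolding a_def by (rule C)
      also have "\<dots> \<le> C * (K ^ k * norm x)"
        using C norm_iter by (intro mult_left_mono)
      finally show "a k \<le> C * norm x * K ^ k" by (simp add: ac_simps)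
    qed (use K in \<open>simp_all add: a_def\<close>)
    then show ?thesis by (simp add: a_def)
  qed
  then show ?thesis
    using K unfolding bounded_A_def by (intro exI[of _ K]) auto
qed

lemma bounded_A_compose:
  assumes "bounded_A A S" "bounded_A A T"
  shows "bounded_A A (\<lambda>x. S (T x))"
proof -
  obtain K where K: "0 \<le> K" "\<And>x. nA (S x) \<le> K * nA x"
    using assms(1) unfolding bounded_A_def by blast
  obtain L where L: "0 \<le> L" "\<And>x. nA (T x) \<le> L * nA x"
    using assms(2) unfolding bounded_A_def by blast
  have "nA (S (T x)) \<le> (K * L) * nA x" for x
    using K(2)[of "T x"] mult_left_mono[OF L(2)[of x] K(1)] by (simp add: mult.assoc)
  then show ?thesis
    using K(1) L(1) unfolding bounded_A_def by (intro exI[of _ "K * L"]) auto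
qed

lemma bounded_A_add:
  assumes "bounded_A A S" "bounded_A A T"
  shows "bounded_A A (\<lambda>x. S x + T x)"
proof -
  obtain K where K: "0 \<le> K" "\<And>x. nA (S x) \<le> K * nA x"
    using assms(1) unfolding bounded_A_def by blast
  obtain L where L: "0 \<le> L" "\<And>x. nA (T x) \<le> L * nA x"
    using assms(2) unfolding bounded_A_def by blast
  have "nA (S x + T x) \<le> (K + L) * nA x" for x
    using nA_triangle[of "S x" "T x"] K(2)[of x] L(2)[of x] by (simp add: distrib_right)
  then show ?thesis
    using K(1) L(1) unfolding bounded_A_def by (intro exI[of _ "K + L"]) auto
qed

lemma ip_adjoint_left:
  assumes "T \<in> B_A A"
  shows "ip (adjoint_A A T x) y = ip x (T y)"
  using adjoint_A_props(2)[OF assms, of y x] ip_commute by metis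

text \<open>
  The operator \<open>adjoint_A A T \<circ> T\<close> is symmetric for the semi-inner product, and its quadratic form is the
  squared seminorm of \<open>T x\<close>.
\<close>

lemma B_A_imp_bounded_A:
  assumes T: "T \<in> B_A A"
  shows "bounded_A A T"
proof -
  have "bounded_A A (adjoint_A A T \<circ> T)"
    using T by (intro symmetric_imp_bounded_A bounded_clinear_compose adjoint_A_props)
      (simp_all add: B_A_def ip_adjoint_left adjoint_A_props(2))
  then obtain K where K: "0 \<le> K" "\<And>x. nA (adjoint_A A T (T x)) \<le> K * nA x"
    unfolding bounded_A_def by auto
  have "nA (T x) \<le> sqrt K * nA x" for x
  proof (rule power2_le_imp_le)
    have "(nA (T x))\<^sup>2 = Re (ip (adjoint_A A T (T x)) x)"
      by (simp add: ip_adjoint_left[OF T] flip: Re_ip_self)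
    also have "\<dots> \<le> nA (adjoint_A A T (T x)) * nA x"
      by (rule Re_ip_le)
    also have "\<dots> \<le> (K * nA x) * nA x"
      using K by (intro mult_right_mono) auto
    also have "\<dots> = (sqrt K)\<^sup>2 * (nA x)\<^sup>2"
      using K(1) by (simp add: power2_eq_square)
    finally show "(nA (T x))\<^sup>2 \<le> (sqrt K * nA x)\<^sup>2"
      by (simp only: power_mult_distrib)
  qed (use K in simp)
  then show ?thesis
    using K unfolding bounded_A_def by (intro exI[of _ "sqrt K"]) auto
qed

lemma bounded_A_adjoint_A:
  assumes T: "T \<in> B_A A"
  shows "bounded_A A (adjoint_A A T)"
proof -
  obtain K where K: "0 \<le> K" "\<And>x. nA (T x) \<le> K * nA x"
    using B_A_imp_bounded_A[OF T] unfolding bounded_A_def by auto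
  have "nA (adjoint_A A T x) \<le> K * nA x" for x
  proof (rule nA_le_if_square)
    have "(nA (adjoint_A A T x))\<^sup>2 = Re (ip (T (adjoint_A A T x)) x)"
      by (simp add: adjoint_A_props(2)[OF T] flip: Re_ip_self)
    also have "\<dots> \<le> nA (T (adjoint_A A T x)) * nA x"
      by (rule Re_ip_le)
    also have "\<dots> \<le> (K * nA (adjoint_A A T x)) * nA x"
      using K by (intro mult_right_mono) auto
    finally show "(nA (adjoint_A A T x))\<^sup>2 \<le> (K * nA x) * nA (adjoint_A A T x)"
      by (simp add: ac_simps)
  qed (use K in simp)
  then show ?thesis
    using K unfolding bounded_A_def by (intro exI[of _ K]) auto
qed

section \<open>Numerical radius, Crawford number and operator seminorm\<close>

lemma normalize:
  assumes "nA x \<noteq> 0"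
  obtains u where "nA u = 1" "x = complex_of_real (nA x) *\<^sub>C u"
proof
  show "nA (complex_of_real (1 / nA x) *\<^sub>C x) = 1"
    using assms by (simp add: nA_scaleC norm_divide)
  show "x = complex_of_real (nA x) *\<^sub>C complex_of_real (1 / nA x) *\<^sub>C x"
    using assms by (simp add: scaleC_scaleC scaleC_one flip: of_real_mult)
qed

lemma bounded_A_null:
  assumes "bounded_A A T" "nA x = 0"
  shows "nA (T x) = 0"
proof -
  obtain K where "nA (T x) \<le> K * nA x"
    using assms(1) unfolding bounded_A_def by blast
  then have "nA (T x) \<le> 0"
    using assms(2) by simp
  then show ?thesis
    using nA_nonneg[of "T x"] by linarith
qed

lemma w_A_bdd:
  assumes "bounded_A A T"
  shows "bdd_above ((\<lambda>x. cmod (ip (T x) x)) ` {x. nA x = 1})"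
proof -
  obtain K where K: "0 \<le> K" "\<And>x. nA (T x) \<le> K * nA x"
    using assms unfolding bounded_A_def by auto
  have "cmod (ip (T x) x) \<le> K" if "nA x = 1" for x
    using Cauchy_Schwarz_A[of "T x" x] K(2)[of x] that by simp
  then show ?thesis by (intro bdd_aboveI2) auto
qed

lemma cmod_le_w_A:
  assumes "bounded_A A T" "\<And>c x. T (c *\<^sub>C x) = c *\<^sub>C T x"
  shows "cmod (ip (T x) x) \<le> w_A A T * (nA x)\<^sup>2"
proof (cases "nA x = 0")
  case True
  then show ?thesis using Cauchy_Schwarz_A[of "T x" x] by simp
next
  case False
  then obtain u where u: "nA u = 1" "x = complex_of_real (nA x) *\<^sub>C u"
    by (rule normalize)
  have "cmod (ip (T x) x) = cmod (ip (T u) u) * (nA x)\<^sup>2"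
    by (subst (1 2) u(2)) (simp add: assms(2) ip_scaleC_left ip_scaleC_right norm_mult power2_eq_square)
  also have "\<dots> \<le> w_A A T * (nA x)\<^sup>2"
    unfolding w_A_def using u(1) w_A_bdd[OF assms(1)]
    by (intro mult_right_mono cSUP_upper) auto
  finally show ?thesis .
qed

lemma w_A_le:
  assumes "\<And>x. nA x = 1 \<Longrightarrow> cmod (ip (T x) x) \<le> K"
  shows "w_A A T \<le> K"
  unfolding w_A_def using ex_unit assms by (intro cSUP_least) auto

lemma w_A_nonneg:
  assumes "bounded_A A T"
  shows "0 \<le> w_A A T"
proof -
  obtain u where "nA u = 1" using ex_unit by blast
  then have "cmod (ip (T u) u) \<le> w_A A T"
    unfolding w_A_def using w_A_bdd[OF assms] by (intro cSUP_upper) auto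
  then show ?thesis by (meson norm_ge_zero order.trans)
qed

lemma c_A_le: "nA x = 1 \<Longrightarrow> c_A A T \<le> cmod (ip (T x) x)"
  unfolding c_A_def by (intro cINF_lower bdd_belowI2[where m = 0]) auto

lemma m_A_inner_nonneg: "0 \<le> (INF x\<in>{x. nA x = 1}. nA (f x))"
  using ex_unit by (intro cINF_greatest) auto

lemma m_A_nonneg: "0 \<le> m_A A T"
  unfolding m_A_def by (intro cINF_greatest m_A_inner_nonneg) auto

lemma m_A_le:
  assumes "nA x = 1" "cmod \<omega> = 1"
  shows "m_A A T \<le> nA (Re_A A (\<lambda>y. \<omega> *\<^sub>C T y) x)"
proof -
  obtain \<theta> :: real where \<theta>: "\<omega> = exp (\<i> * complex_of_real \<theta>)"
    using Arg_eq[of \<omega>] assms(2) by force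
  have "m_A A T \<le> (INF x\<in>{x. nA x = 1}. nA (Re_A A (\<lambda>y. exp (\<i> * complex_of_real \<theta>) *\<^sub>C T y) x))"
    unfolding m_A_def by (intro cINF_lower bdd_belowI2[where m = 0] m_A_inner_nonneg) auto
  also have "\<dots> \<le> nA (Re_A A (\<lambda>y. exp (\<i> * complex_of_real \<theta>) *\<^sub>C T y) x)"
    using assms by (intro cINF_lower bdd_belowI2[where m = 0]) auto
  finally show ?thesis by (simp add: \<theta>)
qed

lemma range_A_nontrivial: "{x \<in> closure (range A). x \<noteq> 0} \<noteq> {}"
proof -
  obtain x where "A x \<noteq> 0" using nonzero by blast
  then show ?thesis using closure_subset[of "range A"] by auto
qed

text \<open>
  The supremum in \<open>opnorm_A\<close> only ranges over the closure of \<open>range A\<close>.  An arbitrary vector has the same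
  seminorm as its projection there, and an operator bounded for the seminorm respects null vectors.
\<close>

lemma nA_le_opnorm_A:
  assumes T: "bounded_clinear T" and bdd: "bounded_A A T"
  shows "nA (T x) \<le> opnorm_A A T * nA x"
proof -
  obtain K where K: "0 \<le> K" "\<And>x. nA (T x) \<le> K * nA x"
    using bdd unfolding bounded_A_def by auto
  have *: "nA (T x) / nA x \<le> K" for x
    using K by (cases "nA x = 0") (auto simp: field_simps less_le)
  obtain m k where mk: "x = m + k" "m \<in> closure (range A)" "A k = 0"
    by (rule split_closure_range)
  have k0: "nA k = 0" using mk(3) by (rule nA_null)
  have "m = x + (- 1) *\<^sub>C k"
    using mk(1) scaleR_scaleC[of "- 1" k] by (simp add: add_eq_0_iff)
  then have "nA m \<le> nA x + cmod (- 1) * nA k"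
    using nA_triangle[of x "(- 1) *\<^sub>C k"] by (simp add: nA_scaleC)
  then have m_le: "nA m \<le> nA x" using k0 by simp
  have "nA (T x) \<le> nA (T m) + nA (T k)"
    unfolding mk(1) bounded_clinearD(2)[OF T] by (rule nA_triangle)
  then have Tx: "nA (T x) \<le> nA (T m)"
    using bounded_A_null[OF bdd k0] by simp
  show ?thesis
  proof (cases "nA m = 0")
    case True
    then have "nA (T m) = 0" by (rule bounded_A_null[OF bdd])
    moreover have "nA x \<le> 0"
      using nA_triangle[of m k] True k0 mk(1) by simp
    then have "nA x = 0"
      using nA_nonneg[of x] by linarith
    ultimately show ?thesis using Tx by simp
  next
    case False
    then have "m \<noteq> 0"
      using nA_null[of m] by (auto simp: A_linear)
    then have "nA (T m) / nA m \<le> opnorm_A A T"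
      unfolding opnorm_A_def using mk(2) * by (intro cSUP_upper bdd_aboveI2[where M = K]) auto
    moreover from this have "0 \<le> opnorm_A A T"
      by (rule order.trans[rotated]) simp
    ultimately have "nA (T m) \<le> opnorm_A A T * nA m" "0 \<le> opnorm_A A T"
      using False by (simp_all add: pos_divide_le_eq less_le)
    then show ?thesis
      using Tx m_le by (meson mult_left_mono order.trans)
  qed
qed

lemma opnorm_A_le:
  assumes T: "bounded_clinear T" and "0 \<le> L" "\<And>x. nA x = 1 \<Longrightarrow> nA (T x) \<le> L"
  shows "opnorm_A A T \<le> L"
  unfolding opnorm_A_def
proof (intro cSUP_least range_A_nontrivial)
  fix x
  show "nA (T x) / nA x \<le> L"
  proof (cases "nA x = 0")
    case False
    then obtain u where u: "nA u = 1" "x = complex_of_real (nA x) *\<^sub>C u"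
      by (rule normalize)
    have "nA (T x) = nA x * nA (T u)"
      by (subst u(2)) (simp add: bounded_clinearD[OF T] nA_scaleC)
    then show ?thesis using False u assms(3) by simp
  qed (use assms in simp)
qed

lemma opnorm_A_nonneg:
  assumes T: "bounded_clinear T" and bdd: "bounded_A A T"
  shows "0 \<le> opnorm_A A T"
proof -
  obtain u where "nA u = 1" using ex_unit by blast
  then show ?thesis
    using order.trans[OF nA_nonneg nA_le_opnorm_A[OF assms, of u]] by simp
qed

text \<open>
  For symmetric operators the numerical radius dominates the operator seminorm: polarization bounds
  \<open>Re (ip (R x) y)\<close> by values of the quadratic form, and then \<open>y\<close> is taken as a multiple of \<open>R x\<close>.
\<close>

lemma nA_symmetric_le:
  assumes R: "bounded_clinear R" and sym: "\<And>x y. ip (R x) y = ip x (R y)"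
    and w: "0 \<le> w" "\<And>x. cmod (ip (R x) x) \<le> w * (nA x)\<^sup>2"
  shows "nA (R x) \<le> w * nA x"
proof -
  have "nA (R x) \<le> 2 * (w / 2) * nA x"
  proof (rule le_if_scaled_le)
    fix t :: real
    define y where "y = complex_of_real t *\<^sub>C R x"
    have neg: "nA ((- 1) *\<^sub>C y) = nA y" by (simp add: nA_scaleC)
    have "Re (ip y (R x)) = Re (ip (R x) y)"
      by (metis cnj.simps(1) ip_commute)
    then have "4 * Re (ip (R x) y)
        = Re (ip (R (x + y)) (x + y)) - Re (ip (R (x + (- 1) *\<^sub>C y)) (x + (- 1) *\<^sub>C y))"
      by (simp add: bounded_clinearD[OF R] ip_add_left ip_add_right ip_scaleC_left
          ip_scaleC_right sym[of y x])
    also have "\<dots> \<le> w * (nA (x + y))\<^sup>2 + w * (nA (x + (- 1) *\<^sub>C y))\<^sup>2"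
      using w(2)[of "x + y"] w(2)[of "x + (- 1) *\<^sub>C y"]
        complex_Re_le_cmod[of "ip (R (x + y)) (x + y)"]
        abs_Re_le_cmod[of "ip (R (x + (- 1) *\<^sub>C y)) (x + (- 1) *\<^sub>C y)"] by linarith
    also have "\<dots> = 2 * w * ((nA x)\<^sup>2 + (nA y)\<^sup>2)"
      unfolding nA_add_square neg by (simp add: ip_scaleC_right algebra_simps)
    finally show "t * (nA (R x))\<^sup>2 \<le> w / 2 * (t\<^sup>2 * (nA (R x))\<^sup>2 + (nA x)\<^sup>2)"
      by (simp add: y_def nA_scaleC ip_scaleC_right ip_self power_mult_distrib algebra_simps)
  qed (use w in simp_all)
  then show ?thesis by simp
qed

lemma ip_Re_A:
  assumes "T \<in> B_A A"
  shows "ip (Re_A A T x) y = (ip (T x) y + ip x (T y)) / 2"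
  using ip_adjoint_left[OF assms]
  by (simp add: Re_A_def ip_scaleC_left ip_add_left)

lemma bounded_clinear_Re_A:
  assumes "T \<in> B_A A"
  shows "bounded_clinear (Re_A A T)"
  unfolding Re_A_def using assms
  by (intro bounded_clinear_scaleC bounded_clinear_add adjoint_A_props) (simp_all add: B_A_def)

end

section \<open>The quadratic form of the off-diagonal part\<close>

text \<open>
  With \<open>T2\<close> above and \<open>T3\<close> below the diagonal, multiplying the block matrix by a unimodular \<open>\<phi>\<close> and taking
  real parts leaves one off-diagonal entry: half of \<open>cnj \<phi>\<close> times the operator \<open>B \<omega>\<close> below, where
  \<open>\<omega> = \<phi>\<^sup>2\<close>.  The Gram operator of \<open>B \<omega>\<close> is \<open>Q \<omega>\<close>, and this is where the
  quantities of the theorem come from.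
\<close>

locale off_diagonal_blocks = nonzero_positive_operator A
  for A :: "'a::chilbert_space \<Rightarrow> 'a" +
  fixes T2 T3 :: "'a \<Rightarrow> 'a"
  assumes T2: "T2 \<in> B_A A" and T3: "T3 \<in> B_A A"
begin

definition P :: "'a \<Rightarrow> 'a"
  where "P x = adjoint_A A T2 (T2 x) + T3 (adjoint_A A T3 x)"

abbreviation S :: "'a \<Rightarrow> 'a" where "S \<equiv> T3 \<circ> T2"

definition R :: "complex \<Rightarrow> 'a \<Rightarrow> 'a"
  where "R \<omega> = Re_A A (\<lambda>y. \<omega> *\<^sub>C S y)"

abbreviation PS :: "'a \<Rightarrow> 'a"
  where "PS \<equiv> \<lambda>x. P (T3 (T2 x)) + T3 (T2 (P x))"

definition B :: "complex \<Rightarrow> 'a \<Rightarrow> 'a"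
  where "B \<omega> y = \<omega> *\<^sub>C T2 y + adjoint_A A T3 y"

definition Q :: "complex \<Rightarrow> 'a \<Rightarrow> 'a"
  where "Q \<omega> y = P y + 2 *\<^sub>C R \<omega> y"

lemma T2_T3_linear: "bounded_clinear T2" "bounded_clinear T3"
  using T2 T3 by (simp_all add: B_A_def)

lemma rotated_S: "(\<lambda>y. \<omega> *\<^sub>C S y) \<in> B_A A"
  by (intro B_A_scaleC B_A_compose T2 T3)

lemma bounded_clinear_P: "bounded_clinear P"
proof -
  have "bounded_clinear (\<lambda>x. (adjoint_A A T2 \<circ> T2) x + (T3 \<circ> adjoint_A A T3) x)"
    by (intro bounded_clinear_add bounded_clinear_compose adjoint_A_props T2_T3_linear T2 T3)
  then show ?thesis
    by (simp add: P_def[abs_def])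
qed

lemma bounded_A_P: "bounded_A A P"
  unfolding P_def[abs_def]
  by (rule bounded_A_add[OF
        bounded_A_compose[OF bounded_A_adjoint_A[OF T2] B_A_imp_bounded_A[OF T2]]
        bounded_A_compose[OF B_A_imp_bounded_A[OF T3] bounded_A_adjoint_A[OF T3]]])

lemma bounded_A_S: "bounded_A A S"
  by (intro B_A_imp_bounded_A B_A_compose T2 T3)

lemma bounded_A_PS: "bounded_A A PS"
proof (rule bounded_A_add)
  have "bounded_A A (\<lambda>x. P (S x))" "bounded_A A (\<lambda>x. S (P x))"
    by (rule bounded_A_compose[OF bounded_A_P bounded_A_S] bounded_A_compose[OF bounded_A_S bounded_A_P])+
  then show "bounded_A A (\<lambda>x. P (T3 (T2 x)))" "bounded_A A (\<lambda>x. T3 (T2 (P x)))"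
    by simp_all
qed

lemma scaleC_PS: "PS (c *\<^sub>C x) = c *\<^sub>C PS x"
  by (simp add: bounded_clinearD[OF bounded_clinear_P] bounded_clinearD[OF T2_T3_linear(1)]
      bounded_clinearD[OF T2_T3_linear(2)] scaleC_add_right)

lemma ip_P: "ip (P x) y = ip (T2 x) (T2 y) + ip (adjoint_A A T3 x) (adjoint_A A T3 y)"
  by (simp add: P_def ip_add_left ip_adjoint_left[OF T2] adjoint_A_props(2)[OF T3])

lemma P_symmetric: "ip (P x) y = ip x (P y)"
  unfolding ip_P by (subst (1 2 3) ip_commute) (simp add: ip_P)

lemma ip_R: "ip (R \<omega> x) y = (\<omega> * ip (S x) y + cnj \<omega> * ip x (S y)) / 2"
  by (simp only: R_def ip_Re_A[OF rotated_S] ip_scaleC_left ip_scaleC_right)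

lemma R_symmetric: "ip (R \<omega> x) y = ip x (R \<omega> y)"
proof -
  have "ip x (R \<omega> y) = cnj (ip (R \<omega> y) x)"
    by (rule ip_commute)
  also have "\<dots> = (cnj \<omega> * cnj (ip (S y) x) + \<omega> * cnj (ip y (S x))) / 2"
    by (simp add: ip_R)
  also have "\<dots> = ip (R \<omega> x) y"
    by (simp add: ip_R flip: ip_commute)
  finally show ?thesis by simp
qed

lemma nA_R_le:
  assumes "cmod \<omega> = 1"
  shows "nA (R \<omega> x) \<le> w_A A S * nA x"
proof (rule nA_symmetric_le[OF _ R_symmetric w_A_nonneg[OF bounded_A_S]])
  show "bounded_clinear (R \<omega>)"
    unfolding R_def by (rule bounded_clinear_Re_A[OF rotated_S])
  fix x
  have "cmod (ip (R \<omega> x) x) \<le> (cmod (\<omega> * ip (S x) x) + cmod (cnj \<omega> * ip x (S x))) / 2"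
    unfolding ip_R norm_divide using norm_triangle_ineq by (simp add: divide_right_mono)
  also have "cmod (ip x (S x)) = cmod (ip (S x) x)"
    by (metis complex_mod_cnj ip_commute)
  then have "(cmod (\<omega> * ip (S x) x) + cmod (cnj \<omega> * ip x (S x))) / 2 = cmod (ip (S x) x)"
    using assms by (simp add: norm_mult)
  also have "\<dots> \<le> w_A A S * (nA x)\<^sup>2"
    by (rule cmod_le_w_A[OF bounded_A_S]) (simp add: bounded_clinearD T2_T3_linear)
  finally show "cmod (ip (R \<omega> x) x) \<le> w_A A S * (nA x)\<^sup>2" .
qed

lemma ip_B_B:
  assumes "cmod \<omega> = 1"
  shows "ip (B \<omega> y) (B \<omega> z) = ip (Q \<omega> y) z"
proof -
  have \<omega>: "\<omega> * cnj \<omega> = 1"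
    using assms complex_norm_square[of \<omega>] by simp
  have "ip (B \<omega> y) (B \<omega> z) = (\<omega> * cnj \<omega>) * ip (T2 y) (T2 z) + ip (adjoint_A A T3 y) (adjoint_A A T3 z)
      + \<omega> * ip (T2 y) (adjoint_A A T3 z) + cnj \<omega> * ip (adjoint_A A T3 y) (T2 z)"
    by (simp add: B_def ip_add_left ip_add_right ip_scaleC_left ip_scaleC_right distrib_left)
  also have "\<dots> = ip (P y) z + 2 * ip (R \<omega> y) z"
    unfolding \<omega> by (simp add: ip_P ip_R ip_adjoint_left[OF T3] flip: adjoint_A_props(2)[OF T3])
  also have "\<dots> = ip (Q \<omega> y) z"
    by (simp add: Q_def ip_add_left ip_scaleC_left)
  finally show ?thesis .
qed

text \<open>
  Expanding the square of \<open>P + 2 R \<omega>\<close>: the cross terms are the real part of the rotated operator \<open>PS\<close>.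
  Both bounds of the theorem are read off from this identity.
\<close>

lemma nA_Q_square:
  "(nA (Q \<omega> y))\<^sup>2 = (nA (P y))\<^sup>2 + 4 * (nA (R \<omega> y))\<^sup>2 + 2 * Re (\<omega> * ip (PS y) y)"
proof -
  have "ip (R \<omega> y) (P y) = (\<omega> * ip (P (S y)) y + cnj (\<omega> * ip (S (P y)) y)) / 2"
    unfolding ip_R P_symmetric by (simp flip: ip_commute)
  then have "Re (ip (R \<omega> y) (P y)) = (Re (\<omega> * ip (P (S y)) y) + Re (\<omega> * ip (S (P y)) y)) / 2"
    by (simp only:) simp
  then have "2 * Re (ip (R \<omega> y) (P y)) = Re (\<omega> * ip (PS y) y)"
    by (simp add: ip_add_left algebra_simps)
  moreover have "Re (ip (P y) (2 *\<^sub>C R \<omega> y)) = 2 * Re (ip (R \<omega> y) (P y))"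
    by (subst ip_commute) (simp add: ip_scaleC_left)
  ultimately show ?thesis
    by (simp add: Q_def nA_add_square nA_scaleC power_mult_distrib)
qed

abbreviation off :: "'a \<Rightarrow> 'a \<Rightarrow> complex"
  where "off x y \<equiv> ip (T2 y) x + ip (T3 x) y"

lemma Re_rotated_off:
  assumes "cmod \<phi> = 1"
  shows "Re (\<phi> * off x y) = Re (ip (cnj \<phi> *\<^sub>C B (\<phi>\<^sup>2) y) x)"
proof -
  have \<phi>: "cnj \<phi> * \<phi>\<^sup>2 = \<phi>"
    using assms complex_norm_square[of \<phi>] by (simp add: power2_eq_square algebra_simps)
  have "ip (T3 x) y = cnj (ip (adjoint_A A T3 y) x)"
    unfolding adjoint_A_props(2)[OF T3] by (rule ip_commute)
  then have "Re (\<phi> * ip (T3 x) y) = Re (cnj \<phi> * ip (adjoint_A A T3 y) x)"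
    by simp
  moreover have "ip (cnj \<phi> *\<^sub>C B (\<phi>\<^sup>2) y) x = \<phi> * ip (T2 y) x + cnj \<phi> * ip (adjoint_A A T3 y) x"
    by (simp add: B_def ip_scaleC_left ip_add_left distrib_left \<phi> flip: mult.assoc)
  ultimately show ?thesis
    by (simp only: distrib_left plus_complex.sel)
qed

text \<open>
  All three terms of \<open>nA_Q_square\<close> are bounded by suprema, which bounds \<open>Q \<omega>\<close> and, through the Gram
  identity \<open>ip_B_B\<close>, also \<open>B \<omega>\<close>.
\<close>

lemma cmod_off_le:
  "cmod (off x y) \<le> root 4 (1/16 * (opnorm_A A P)\<^sup>2 + 1/8 * w_A A PS + 1/4 * (w_A A S)\<^sup>2)
     * ((nA x)\<^sup>2 + (nA y)\<^sup>2)"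
proof -
  define N where "N = 1/16 * (opnorm_A A P)\<^sup>2 + 1/8 * w_A A PS + 1/4 * (w_A A S)\<^sup>2"
  define K where "K = root 4 N"
  have "0 \<le> N"
    unfolding N_def using w_A_nonneg[OF bounded_A_PS] by simp
  then have K: "0 \<le> K" "K ^ 4 = N"
    by (simp_all add: K_def)
  obtain \<phi> where \<phi>: "cmod \<phi> = 1" "\<phi> * off x y = complex_of_real (cmod (off x y))"
    using ex_unimodular_rotation by blast
  define \<omega> where "\<omega> = \<phi>\<^sup>2"
  have \<omega>: "cmod \<omega> = 1"
    using \<phi>(1) by (simp add: \<omega>_def norm_power)
  \<comment> \<open>\<open>B \<omega>\<close> is twice the entry of the real part, so \<open>Q \<omega>\<close> is four times the Gram operator of that entry.\<close>
  have "nA (Q \<omega> y) \<le> 4 * K\<^sup>2 * nA y"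
  proof (rule power2_le_imp_le)
    have "(nA (P y))\<^sup>2 \<le> (opnorm_A A P * nA y)\<^sup>2"
      by (intro power_mono nA_le_opnorm_A bounded_clinear_P bounded_A_P) simp
    moreover have "(nA (R \<omega> y))\<^sup>2 \<le> (w_A A S * nA y)\<^sup>2"
      by (intro power_mono nA_R_le \<omega>) simp
    moreover have "Re (\<omega> * ip (PS y) y) \<le> w_A A PS * (nA y)\<^sup>2"
      using cmod_le_w_A[OF bounded_A_PS scaleC_PS, of y] complex_Re_le_cmod[of "\<omega> * ip (PS y) y"] \<omega>
      by (simp add: norm_mult)
    ultimately have "(nA (Q \<omega> y))\<^sup>2 \<le> 16 * N * (nA y)\<^sup>2"
      unfolding nA_Q_square N_def by (simp add: power_mult_distrib algebra_simps)
    then show "(nA (Q \<omega> y))\<^sup>2 \<le> (4 * K\<^sup>2 * nA y)\<^sup>2"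
      by (simp add: power_mult_distrib K(2) flip: power_mult)
  qed simp
  note Q_le = this
  have "nA (B \<omega> y) \<le> 2 * K * nA y"
  proof (rule power2_le_imp_le)
    have "(nA (B \<omega> y))\<^sup>2 = Re (ip (Q \<omega> y) y)"
      by (simp add: ip_B_B[OF \<omega>] flip: Re_ip_self)
    also have "\<dots> \<le> nA (Q \<omega> y) * nA y"
      by (rule Re_ip_le)
    also have "\<dots> \<le> (4 * K\<^sup>2 * nA y) * nA y"
      using Q_le by (intro mult_right_mono) auto
    finally show "(nA (B \<omega> y))\<^sup>2 \<le> (2 * K * nA y)\<^sup>2"
      by (simp add: power2_eq_square ac_simps)
  qed (use K in simp)
  note B_le = this
  have "cmod (off x y) = Re (\<phi> * off x y)"
    unfolding \<phi>(2) by simp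
  also have "\<dots> = Re (ip (cnj \<phi> *\<^sub>C B \<omega> y) x)"
    unfolding \<omega>_def by (rule Re_rotated_off[OF \<phi>(1)])
  also have "\<dots> \<le> nA (B \<omega> y) * nA x"
    using Re_ip_le[of "cnj \<phi> *\<^sub>C B \<omega> y" x] \<phi>(1) by (simp add: nA_scaleC)
  also have "\<dots> \<le> (2 * K * nA y) * nA x"
    using B_le by (intro mult_right_mono) auto
  also have "\<dots> = K * (2 * nA x * nA y)"
    by simp
  also have "\<dots> \<le> K * ((nA x)\<^sup>2 + (nA y)\<^sup>2)"
    using K sum_squares_bound[of "nA x" "nA y"] by (intro mult_left_mono) auto
  finally show ?thesis
    by (simp add: K_def N_def)
qed

text \<open>
  A bound of the quadratic form bounds \<open>B \<omega>\<close>, since the vector \<open>x\<close> may be taken as a multiple of the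
  rotated \<open>B \<omega> y\<close>; the Gram identity passes the bound on to \<open>Q \<omega>\<close>.
\<close>

lemma nA_Q_le_if_off_le:
  assumes off: "\<And>x y. cmod (off x y) \<le> W * ((nA x)\<^sup>2 + (nA y)\<^sup>2)"
    and "0 \<le> W" "cmod \<omega> = 1"
  shows "nA (Q \<omega> y) \<le> 4 * W\<^sup>2 * nA y"
proof -
  define \<phi> where "\<phi> = csqrt \<omega>"
  have \<phi>: "\<phi>\<^sup>2 = \<omega>" "cmod \<phi> = 1"
    using assms(3) by (simp_all add: \<phi>_def)
  have B_le: "nA (B \<omega> y) \<le> 2 * W * nA y" for y
  proof (rule le_if_scaled_le)
    fix t :: real assume "0 < t"
    define z where "z = cnj \<phi> *\<^sub>C B \<omega> y"
    have nz: "nA z = nA (B \<omega> y)"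
      using \<phi> by (simp add: z_def nA_scaleC)
    have "t * (nA (B \<omega> y))\<^sup>2 = Re (ip z (complex_of_real t *\<^sub>C z))"
      by (simp add: ip_scaleC_right ip_self nz)
    also have "\<dots> = Re (\<phi> * off (complex_of_real t *\<^sub>C z) y)"
      unfolding Re_rotated_off[OF \<phi>(2)] by (simp add: z_def \<phi>)
    also have "\<dots> \<le> cmod (\<phi> * off (complex_of_real t *\<^sub>C z) y)"
      by (rule complex_Re_le_cmod)
    also have "\<dots> \<le> W * (t\<^sup>2 * (nA (B \<omega> y))\<^sup>2 + (nA y)\<^sup>2)"
      using off[where x = "complex_of_real t *\<^sub>C z" and y = y] \<phi>(2)
      by (simp add: norm_mult nA_scaleC nz power_mult_distrib)
    finally show "t * (nA (B \<omega> y))\<^sup>2 \<le> W * (t\<^sup>2 * (nA (B \<omega> y))\<^sup>2 + (nA y)\<^sup>2)" .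
  qed (use assms in simp_all)
  show ?thesis
  proof (rule nA_le_if_square)
    have "(nA (Q \<omega> y))\<^sup>2 = Re (ip (B \<omega> y) (B \<omega> (Q \<omega> y)))"
      by (simp add: ip_B_B[OF assms(3)] ip_self)
    also have "\<dots> \<le> nA (B \<omega> y) * nA (B \<omega> (Q \<omega> y))"
      by (rule Re_ip_le)
    also have "\<dots> \<le> (2 * W * nA y) * (2 * W * nA (Q \<omega> y))"
      using assms by (intro mult_mono B_le) auto
    finally show "(nA (Q \<omega> y))\<^sup>2 \<le> 4 * W\<^sup>2 * nA y * nA (Q \<omega> y)"
      by (simp add: power2_eq_square ac_simps)
  qed simp
qed

text \<open>
  The converse reading of \<open>nA_Q_square\<close>: for each unit vector \<open>y\<close> the phase \<open>\<omega>\<close> is chosen so that the mixed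
  term equals the modulus bounded below by \<open>c_A\<close>, while \<open>m_A\<close> bounds the middle term for every phase.
  What remains is a bound of \<open>nA (P y)\<close> uniform in \<open>y\<close>, hence one of \<open>opnorm_A A P\<close>.
\<close>

lemma root_le_if_off_le:
  assumes off: "\<And>x y. cmod (off x y) \<le> W * ((nA x)\<^sup>2 + (nA y)\<^sup>2)" and "0 \<le> W"
  shows "root 4 (1/16 * (opnorm_A A P)\<^sup>2 + 1/8 * c_A A PS + 1/4 * (m_A A S)\<^sup>2) \<le> W"
proof -
  define L where "L = 16 * W ^ 4 - 2 * c_A A PS - 4 * (m_A A S)\<^sup>2"
  have P_le: "(nA (P y))\<^sup>2 \<le> L" if "nA y = 1" for y
  proof -
    obtain \<omega> where \<omega>: "cmod \<omega> = 1" "\<omega> * ip (PS y) y = complex_of_real (cmod (ip (PS y) y))"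
      using ex_unimodular_rotation by blast
    have "(nA (Q \<omega> y))\<^sup>2 \<le> (4 * W\<^sup>2 * nA y)\<^sup>2"
      by (intro power_mono nA_Q_le_if_off_le assms \<omega>) simp
    then have "(nA (Q \<omega> y))\<^sup>2 \<le> 16 * W ^ 4"
      by (simp add: that power_mult_distrib flip: power_mult)
    moreover have "(m_A A S)\<^sup>2 \<le> (nA (R \<omega> y))\<^sup>2"
      unfolding R_def by (intro power_mono m_A_le m_A_nonneg that \<omega>)
    moreover have "c_A A PS \<le> cmod (ip (PS y) y)"
      using that by (rule c_A_le)
    ultimately show ?thesis
      using nA_Q_square[of \<omega> y] unfolding \<omega>(2) L_def by simp
  qed
  have "0 \<le> L"
    using ex_unit P_le by (meson order.trans zero_le_power2)
  have "opnorm_A A P \<le> sqrt L"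
    by (intro opnorm_A_le bounded_clinear_P real_le_rsqrt P_le) (use \<open>0 \<le> L\<close> in simp)
  then have "(opnorm_A A P)\<^sup>2 \<le> L"
    using opnorm_A_nonneg[OF bounded_clinear_P bounded_A_P] \<open>0 \<le> L\<close>
    by (metis power_mono real_sqrt_pow2)
  then have "1/16 * (opnorm_A A P)\<^sup>2 + 1/8 * c_A A PS + 1/4 * (m_A A S)\<^sup>2 \<le> W ^ 4"
    by (simp add: L_def)
  then have "root 4 (1/16 * (opnorm_A A P)\<^sup>2 + 1/8 * c_A A PS + 1/4 * (m_A A S)\<^sup>2) \<le> root 4 (W ^ 4)"
    by simp
  then show ?thesis
    using \<open>0 \<le> W\<close> by (simp add: real_root_power_cancel)
qed

end

section \<open>The diagonal operator on the Hilbert sum\<close>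

context nonzero_positive_operator
begin

lemma cinner_A_diag_op: "cinner_A (diag_op A) (x, y) (u, v) = ip x u + ip y v"
  by (simp add: cinner_A_def diag_op_def block_op_def cinner_prod_def)

lemma norm_A_diag_op_square: "(norm_A (diag_op A) (x, y))\<^sup>2 = (nA x)\<^sup>2 + (nA y)\<^sup>2"
  by (simp add: norm_A_def[of "diag_op A"] cinner_A_diag_op ip_self)

lemma diag_op_nonzero_positive: "nonzero_positive_operator (diag_op A)"
proof
  have bl: "bounded_clinear (diag_op A)"
    unfolding bounded_clinear_def
  proof (intro conjI allI)
    have "diag_op A = (\<lambda>z. (A (fst z), A (snd z)))"
      by (auto simp: diag_op_def block_op_def)
    then show "bounded_linear (diag_op A)"
      by (simp add: bounded_linear_Pair bounded_linear_compose[OF A_linear(1)]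
          bounded_linear_fst bounded_linear_snd)
    show "diag_op A (c *\<^sub>C z) = c *\<^sub>C diag_op A z" for c z
      by (cases z) (simp add: diag_op_def block_op_def scaleC_prod_def A_linear)
  qed
  have sym: "cinner (diag_op A z) w = cinner z (diag_op A w)" for z w
    by (cases z; cases w) (simp add: diag_op_def block_op_def cinner_prod_def A_selfadjoint)
  have "cadjoint (diag_op A) = diag_op A"
  proof
    fix w
    have "z \<bullet> cadjoint (diag_op A) w = z \<bullet> diag_op A w" for z
      by (metis Re_cinner bl cadjoint_works sym)
    then show "cadjoint (diag_op A) w = diag_op A w"
      by (metis vector_eq_ldot)
  qed
  moreover have "cinner (diag_op A z) z \<in> \<real>\<^sub>\<ge>\<^sub>0" for z
  proof (cases z)
    case (Pair x y)
    have "cinner (diag_op A z) z = ip x x + ip y y"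
      using cinner_A_diag_op[of x y x y] by (simp add: Pair cinner_A_def)
    then show ?thesis
      by (simp add: ip_self flip: of_real_power of_real_add)
  qed
  ultimately show "positive_op (diag_op A)"
    using bl by (simp add: positive_op_def)
  obtain x where "A x \<noteq> 0" using nonzero by blast
  then have "diag_op A (x, 0) \<noteq> 0"
    by (simp add: diag_op_def block_op_def zero_prod_def)
  then show "diag_op A \<noteq> (\<lambda>_. 0)" by auto
qed

lemma nA_fst_snd_le: "nA x \<le> norm_A (diag_op A) (x, y)" "nA y \<le> norm_A (diag_op A) (x, y)"
  "norm_A (diag_op A) (x, y) \<le> nA x + nA y"
proof -
  interpret D: nonzero_positive_operator "diag_op A"
    by (rule diag_op_nonzero_positive)
  show "nA x \<le> norm_A (diag_op A) (x, y)" "nA y \<le> norm_A (diag_op A) (x, y)"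
    by (rule power2_le_imp_le; simp add: norm_A_diag_op_square)+
  show "norm_A (diag_op A) (x, y) \<le> nA x + nA y"
    by (rule power2_le_imp_le) (simp_all add: norm_A_diag_op_square power2_sum)
qed

lemma bounded_A_block_op:
  assumes "bounded_A A T1" "bounded_A A T2" "bounded_A A T3" "bounded_A A T4"
  shows "bounded_A (diag_op A) (block_op T1 T2 T3 T4)"
proof -
  obtain K1 K2 K3 K4 where K: "0 \<le> K1" "0 \<le> K2" "0 \<le> K3" "0 \<le> K4"
      "\<And>x. nA (T1 x) \<le> K1 * nA x" "\<And>x. nA (T2 x) \<le> K2 * nA x"
      "\<And>x. nA (T3 x) \<le> K3 * nA x" "\<And>x. nA (T4 x) \<le> K4 * nA x"
    using assms unfolding bounded_A_def by metis
  have "norm_A (diag_op A) (block_op T1 T2 T3 T4 (x, y))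
      \<le> (K1 + K2 + K3 + K4) * norm_A (diag_op A) (x, y)" for x y
  proof -
    let ?n = "norm_A (diag_op A) (x, y)"
    have "norm_A (diag_op A) (block_op T1 T2 T3 T4 (x, y)) \<le> nA (T1 x + T2 y) + nA (T3 x + T4 y)"
      by (simp add: block_op_def nA_fst_snd_le)
    also have "\<dots> \<le> nA (T1 x) + nA (T2 y) + (nA (T3 x) + nA (T4 y))"
      by (intro add_mono nA_triangle)
    also have "\<dots> \<le> K1 * nA x + K2 * nA y + (K3 * nA x + K4 * nA y)"
      by (intro add_mono K)
    also have "\<dots> \<le> K1 * ?n + K2 * ?n + (K3 * ?n + K4 * ?n)"
      by (intro add_mono mult_left_mono K nA_fst_snd_le)
    finally show ?thesis by (simp add: distrib_right)
  qed
  then show ?thesis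
    using K unfolding bounded_A_def by (intro exI[of _ "K1 + K2 + K3 + K4"]) auto
qed

end

theorem theorem3p17:
  fixes A T1 T2 T3 T4 P :: "'a::chilbert_space \<Rightarrow> 'a"
  assumes "positive_op A" and "A \<noteq> (\<lambda>_. 0)"
    and "T1 \<in> B_A A" and "T2 \<in> B_A A" and "T3 \<in> B_A A" and "T4 \<in> B_A A"
    and P: "P = (\<lambda>x. adjoint_A A T2 (T2 x) + T3 (adjoint_A A T3 x))"
  shows "w_A (diag_op A) (block_op T1 T2 T3 T4)
      \<le> max (w_A A T1) (w_A A T4)
        + root 4 (1/16 * (opnorm_A A P)\<^sup>2
            + 1/8 * w_A A (\<lambda>x. P (T3 (T2 x)) + T3 (T2 (P x)))
            + 1/4 * (w_A A (T3 \<circ> T2))\<^sup>2) \<and>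
    w_A (diag_op A) (block_op T1 T2 T3 T4)
      \<ge> Max {w_A A T1, w_A A T4,
          root 4 (1/16 * (opnorm_A A P)\<^sup>2
            + 1/8 * c_A A (\<lambda>x. P (T3 (T2 x)) + T3 (T2 (P x)))
            + 1/4 * (m_A A (T3 \<circ> T2))\<^sup>2)}"
proof -
  interpret A: off_diagonal_blocks A T2 T3
    using assms by unfold_locales
  interpret D: nonzero_positive_operator "diag_op A"
    by (rule A.diag_op_nonzero_positive)
  have P_eq: "P = A.P"
    unfolding P by (simp add: A.P_def fun_eq_iff)
  note lin = assms(3-6)[THEN A.B_A_iff[THEN iffD1], THEN conjunct1]
  note bdd = assms(3-6)[THEN A.B_A_imp_bounded_A]
  define T where "T = block_op T1 T2 T3 T4"
  define W where "W = w_A (diag_op A) T"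
  have bdd_T: "bounded_A (diag_op A) T"
    unfolding T_def by (intro A.bounded_A_block_op bdd)
  have "T (c *\<^sub>C z) = c *\<^sub>C T z" for c z
    by (cases z) (simp add: T_def block_op_def scaleC_prod_def lin[THEN bounded_clinearD(3)] scaleC_add_right)
  note form_le = D.cmod_le_w_A[OF bdd_T this, folded W_def]
  have form: "cinner_A (diag_op A) (T (x, y)) (x, y)
      = cinner_A A (T1 x) x + cinner_A A (T4 y) y + A.off x y" for x y
    by (simp add: T_def block_op_def A.cinner_A_diag_op A.ip_add_left)
  have W_nonneg: "0 \<le> W"
    unfolding W_def by (rule D.w_A_nonneg[OF bdd_T])
  have T0: "T1 0 = 0" "T2 0 = 0" "T3 0 = 0" "T4 0 = 0"
    by (simp_all add: lin[THEN bounded_clinearD(5)])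
  have ip0: "cinner_A A x 0 = 0" "cinner_A A 0 x = 0" "norm_A A 0 = 0" for x
    using A.ip_scaleC_right[of x 0 0] A.ip_scaleC_left[of 0 0 x] A.nA_scaleC[of 0 0] 
      scaleR_scaleC[of 0 "0::'a"] by simp_all
  have upper: "W \<le> max (w_A A T1) (w_A A T4) + root 4 (1/16 * (opnorm_A A P)\<^sup>2
            + 1/8 * w_A A (\<lambda>x. P (T3 (T2 x)) + T3 (T2 (P x))) + 1/4 * (w_A A (T3 \<circ> T2))\<^sup>2)"
    (is "_ \<le> ?w + ?r")
    unfolding W_def
  proof (rule D.w_A_le)
    fix z assume "norm_A (diag_op A) z = 1"
    moreover obtain x y where z: "z = (x, y)" by (cases z)
    ultimately have xy: "(norm_A A x)\<^sup>2 + (norm_A A y)\<^sup>2 = 1"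
      using A.norm_A_diag_op_square[of x y] by simp
    have "cmod (cinner_A A (T1 x) x) \<le> ?w * (norm_A A x)\<^sup>2"
      using A.cmod_le_w_A[OF bdd(1) lin(1)[THEN bounded_clinearD(3)], of x]
      by (rule order.trans) (simp add: mult_right_mono)
    moreover have "cmod (cinner_A A (T4 y) y) \<le> ?w * (norm_A A y)\<^sup>2"
      using A.cmod_le_w_A[OF bdd(4) lin(4)[THEN bounded_clinearD(3)], of y]
      by (rule order.trans) (simp add: mult_right_mono)
    moreover have "cmod (A.off x y) \<le> ?r"
      using A.cmod_off_le[where x = x and y = y] by (simp add: xy P_eq)
    ultimately have "cmod (cinner_A A (T1 x) x) + cmod (cinner_A A (T4 y) y) + cmod (A.off x y)
        \<le> ?w * ((norm_A A x)\<^sup>2 + (norm_A A y)\<^sup>2) + ?r"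
      by (simp add: distrib_left)
    then show "cmod (cinner_A (diag_op A) (T z) z) \<le> ?w + ?r"
      unfolding z form xy
      by (smt (verit, best) mult_cancel_left1 norm_triangle_ineq)
  qed
  have "w_A A T1 \<le> W"
  proof (rule A.w_A_le)
    fix x assume "norm_A A x = 1"
    then show "cmod (cinner_A A (T1 x) x) \<le> W"
      using form_le[of "(x, 0)"] by (simp add: form A.norm_A_diag_op_square ip0 T0)
  qed
  moreover have "w_A A T4 \<le> W"
  proof (rule A.w_A_le)
    fix y assume "norm_A A y = 1"
    then show "cmod (cinner_A A (T4 y) y) \<le> W"
      using form_le[of "(0, y)"] by (simp add: form A.norm_A_diag_op_square ip0 T0)
  qed
  moreover have "cmod (A.off x y) \<le> W * ((norm_A A x)\<^sup>2 + (norm_A A y)\<^sup>2)" for x y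
  proof -
    \<comment> \<open>Changing the sign of \<open>y\<close> keeps the diagonal terms of the form and reverses the off-diagonal ones.\<close>
    let ?y = "(- 1) *\<^sub>C y"
    have "2 * A.off x y = cinner_A (diag_op A) (T (x, y)) (x, y)
        - cinner_A (diag_op A) (T (x, ?y)) (x, ?y)"
      unfolding form lin[THEN bounded_clinearD(3)] A.ip_scaleC_left A.ip_scaleC_right by simp
    then have "2 * cmod (A.off x y) \<le> cmod (cinner_A (diag_op A) (T (x, y)) (x, y))
        + cmod (cinner_A (diag_op A) (T (x, ?y)) (x, ?y))"
      by (metis norm_mult norm_numeral norm_triangle_ineq4)
    also have "\<dots> \<le> W * ((norm_A A x)\<^sup>2 + (norm_A A y)\<^sup>2) + W * ((norm_A A x)\<^sup>2 + (norm_A A ?y)\<^sup>2)"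
      unfolding A.norm_A_diag_op_square[symmetric] by (intro add_mono form_le)
    finally show ?thesis
      by (simp add: A.nA_scaleC)
  qed
  note A.root_le_if_off_le[OF this W_nonneg]
  ultimately have "Max {w_A A T1, w_A A T4, root 4 (1/16 * (opnorm_A A P)\<^sup>2
            + 1/8 * c_A A (\<lambda>x. P (T3 (T2 x)) + T3 (T2 (P x))) + 1/4 * (m_A A (T3 \<circ> T2))\<^sup>2)} \<le> W"
    by (simp add: P_eq)
  with upper show ?thesis
    unfolding W_def T_def by blast
qed

end
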